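(* Let $k$ be a field of characteristic $0$ and let $r$ be an nc rational expression in $X=\{X_1,\dots,X_g\}$ over $k$. Assume $r$ admits a realization of dimension $n$ about a point in $M_m(k)^g$. If $r$ is an identity on matrices of size $N=m\lceil\tfrac{mn}{2}\rceil$, then $r$ is a rational identity.
   Context: An nc rational expression in $X$ is a formal expression built from polynomials in the free algebra $k\langle X\rangle$ using addition, multiplication and inversion; its domain $\operatorname{dom} r$ is the set of all $g$-tuples of square matrices over $k$ (of all sizes) at which all inverses occurring in $r$ exist (only expressions with nonempty domain are considered). We say that $r$ is an identity on matrices of size $N$ if $r(A)=0$ for all $A\in\operatorname{dom} r\cap M_N(k)^g$, and that $r$ is a rational identity if $r(A)=0$ for all $A\in\operatorname{dom} r$ (of all sizes), i.e. $r$ represents $0$ in the free skew field. Realizations. Let $\mathcal A=M_m(k)$ and let $Y=\{Y_1,\dots,Y_g\}$ be freely noncommuting letters; $\langle Y\rangle$ is the free monoid on $Y$ and $|w|$ the length of a word $w=w_1\cdots w_{|w|}$. The algebra of generalized polynomials is the free product $\mathcal A\langle Y\rangle=M_m(k)*_kk\langle Y\rangle$, and the algebra of generalized series $\mathcal A\langle\!\langle Y\rangle\!\rangle$ is its completion with respect to the $(Y)$-adic topology. For $Y_i\in Y$ let $\mathcal A^{Y_i}=\sum\mathcal AY_i\mathcal A\subset\mathcal A\langle Y\rangle$ be the $\mathcal A$-bimodule generated by $Y_i$, and $\mathcal A^w=\mathcal A^{w_1}\cdots\mathcal A^{w_{|w|}}$ for $w\in\langle Y\rangle$ (with $\mathcal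 A^1=\mathcal A$). For a series $S$ let $[S,w]\in\mathcal A^w$ denote its component on the word $w$, so $S=\sum_w[S,w]$. A linear representation of dimension $n$ is a triple $(c,A,b)$ with $c\in\mathcal A^{1\times n}$, $b\in\mathcal A^{n\times1}$ and $A$ a collection of matrices $A^{Y_i}\in(\mathcal A^{Y_i})^{n\times n}$, $Y_i\in Y$; write $A^w=A^{w_1}\cdots A^{w_{|w|}}\in(\mathcal A^w)^{n\times n}$. It represents $S$ if $[S,w]=cA^wb$ for all $w\in\langle Y\rangle$. If $r$ is defined at $P\in M_m(k)^g$, then $r(Y+P)$ is a well-defined element of $\mathcal A\langle\!\langle Y\rangle\!\rangle$ (a generalized series is invertible iff its constant term $[S,1]$ is invertible in $\mathcal A$), and a realization of $r$ about $P$ is a linear representation $(c,A,b)$ of the series $r(Y+P)$. *)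

theory Defs
  imports "Jordan_Normal_Form.Matrix" "HOL-Library.Poly_Mapping" "HOL-Algebra.Module"
begin

section \<open>Noncommutative rational expressions\<close>

text \<open>The letters are the elements of a type \<open>'x\<close>. An element of the free algebra
  over \<open>'k\<close> is a finitely supported function from words (lists of letters) to \<open>'k\<close>.\<close>

declare [[typedef_overloaded]]

datatype ('x, 'k::zero) nc_expr =
    NC_Poly "'x list \<Rightarrow>\<^sub>0 'k"
  | NC_Add "('x, 'k) nc_expr" "('x, 'k) nc_expr"
  | NC_Mult "('x, 'k) nc_expr" "('x, 'k) nc_expr"
  | NC_Inv "('x, 'k) nc_expr"

text \<open>Expressions are evaluated in an arbitrary \<open>'k\<close>-algebra \<open>R\<close>, so that the same
  evaluation serves for \<open>r(A)\<close> at a tuple of matrices and for the series \<open>r(Y + P)\<close>.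
  Only the carrier, the ring operations and the scalar multiplication of \<open>R\<close> are used.\<close>

definition nc_word_eval :: "('k, 'a, 'b) module_scheme \<Rightarrow> ('x \<Rightarrow> 'a) \<Rightarrow> 'x list \<Rightarrow> 'a" where
  "nc_word_eval R A w = foldr (\<lambda>x a. A x \<otimes>\<^bsub>R\<^esub> a) w \<one>\<^bsub>R\<^esub>"

definition nc_poly_eval ::
  "('k::zero, 'a, 'b) module_scheme \<Rightarrow> ('x \<Rightarrow> 'a) \<Rightarrow> ('x list \<Rightarrow>\<^sub>0 'k) \<Rightarrow> 'a" where
  "nc_poly_eval R A p =
     (\<Oplus>\<^bsub>R\<^esub>w\<in>Poly_Mapping.keys p. Poly_Mapping.lookup p w \<odot>\<^bsub>R\<^esub> nc_word_eval R A w)"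

text \<open>The value of \<open>nc_eval\<close> is meaningful only where \<open>nc_defined\<close> holds.\<close>

primrec nc_eval ::
  "('k::zero, 'a, 'b) module_scheme \<Rightarrow> ('x \<Rightarrow> 'a) \<Rightarrow> ('x, 'k) nc_expr \<Rightarrow> 'a" where
  "nc_eval R A (NC_Poly p) = nc_poly_eval R A p"
| "nc_eval R A (NC_Add r s) = nc_eval R A r \<oplus>\<^bsub>R\<^esub> nc_eval R A s"
| "nc_eval R A (NC_Mult r s) = nc_eval R A r \<otimes>\<^bsub>R\<^esub> nc_eval R A s"
| "nc_eval R A (NC_Inv r) = inv\<^bsub>R\<^esub> (nc_eval R A r)"

primrec nc_defined ::
  "('k::zero, 'a, 'b) module_scheme \<Rightarrow> ('x \<Rightarrow> 'a) \<Rightarrow> ('x, 'k) nc_expr \<Rightarrow> bool" where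
  "nc_defined R A (NC_Poly p) \<longleftrightarrow> True"
| "nc_defined R A (NC_Add r s) \<longleftrightarrow> nc_defined R A r \<and> nc_defined R A s"
| "nc_defined R A (NC_Mult r s) \<longleftrightarrow> nc_defined R A r \<and> nc_defined R A s"
| "nc_defined R A (NC_Inv r) \<longleftrightarrow> nc_defined R A r \<and> nc_eval R A r \<in> Units R"

abbreviation mat_alg :: "nat \<Rightarrow> ('k::field, 'k mat) module" where
  "mat_alg N \<equiv> module_mat TYPE('k) N N"

definition mat_tuples :: "nat \<Rightarrow> ('x \<Rightarrow> 'k mat) set" where
  "mat_tuples N = {A. \<forall>x. A x \<in> carrier_mat N N}"

text \<open>Matrices have size at least \<open>1\<close>. As types are nonempty, a tuple \<open>A\<close> determines its size.\<close>

definition nc_dom :: "('x, 'k::field) nc_expr \<Rightarrow> ('x \<Rightarrow> 'k mat) set" where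
  "nc_dom r = {A. \<exists>N\<ge>1. A \<in> mat_tuples N \<and> nc_defined (mat_alg N) A r}"

definition identity_on_size :: "('x, 'k::field) nc_expr \<Rightarrow> nat \<Rightarrow> bool" where
  "identity_on_size r N \<longleftrightarrow>
     (\<forall>A \<in> nc_dom r \<inter> mat_tuples N. nc_eval (mat_alg N) A r = 0\<^sub>m N N)"

definition rational_identity :: "('x, 'k::field) nc_expr \<Rightarrow> bool" where
  "rational_identity r \<longleftrightarrow> (\<forall>N. identity_on_size r N)"


section \<open>Generalized series\<close>

text \<open>Let \<open>\<A> = M\<^sub>m(k)\<close> with matrix units \<open>E\<^bsub>pq\<^esub>\<close>, \<open>p, q < m\<close>. As an \<open>\<A>\<close>-bimodule, the
  component \<open>\<A>\<^sup>w\<close> of the free product \<open>\<A> *\<^sub>k k\<langle>Y\<rangle>\<close> is the tensor power of \<open>\<A>\<close>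
  over \<open>k\<close> with \<open>|w| + 1\<close> factors, so it has the \<open>k\<close>-basis
    \<open>E\<^bsub>p\<^sub>0q\<^sub>0\<^esub> w\<^sub>1 E\<^bsub>p\<^sub>1q\<^sub>1\<^esub> w\<^sub>2 \<dots> w\<^sub>l E\<^bsub>p\<^sub>lq\<^sub>l\<^esub>\<close>  (\<open>l = |w|\<close>).
  A generalized series \<open>S\<close> is given by its coordinates: \<open>S w es\<close> is the coefficient of the
  basis element with index list \<open>es = [(p\<^sub>0,q\<^sub>0), \<dots>, (p\<^sub>l,q\<^sub>l)]\<close>. There is no restriction on
  the set of words in the support, which is the \<open>(Y)\<close>-adic completion for a finite
  alphabet.\<close>

type_synonym ('x, 'k) gseries = "'x list \<Rightarrow> (nat \<times> nat) list \<Rightarrow> 'k"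

definition gs_index :: "nat \<Rightarrow> 'x list \<Rightarrow> (nat \<times> nat) list \<Rightarrow> bool" where
  "gs_index m w es \<longleftrightarrow> length es = Suc (length w) \<and> set es \<subseteq> {..<m} \<times> {..<m}"

definition gs_carrier :: "nat \<Rightarrow> ('x, 'k::zero) gseries set" where
  "gs_carrier m = {S. \<forall>w es. \<not> gs_index m w es \<longrightarrow> S w es = 0}"

definition gs_zero :: "('x, 'k::zero) gseries" where
  "gs_zero = (\<lambda>w es. 0)"

definition gs_add :: "('x, 'k::plus) gseries \<Rightarrow> ('x, 'k) gseries \<Rightarrow> ('x, 'k) gseries" where
  "gs_add S T = (\<lambda>w es. S w es + T w es)"

definition gs_smult :: "'k::times \<Rightarrow> ('x, 'k) gseries \<Rightarrow> ('x, 'k) gseries" where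
  "gs_smult c S = (\<lambda>w es. c * S w es)"

text \<open>A basis element with \<open>E\<^bsub>pq\<^esub>\<close> in position \<open>j\<close> is a product of a basis element on the
  first \<open>j\<close> letters of \<open>w\<close> and one on the remaining letters exactly for the \<open>m\<close>
  factorizations \<open>E\<^bsub>pq\<^esub> = E\<^bsub>pt\<^esub> E\<^bsub>tq\<^esub>\<close>; all other products \<open>E\<^bsub>pt\<^esub> E\<^bsub>sq\<^esub>\<close> vanish.\<close>

definition gs_mult ::
  "nat \<Rightarrow> ('x, 'k::semiring_0) gseries \<Rightarrow> ('x, 'k) gseries \<Rightarrow> ('x, 'k) gseries" where
  "gs_mult m S T = (\<lambda>w es.
     if gs_index m w es then
       (\<Sum>j\<le>length w. \<Sum>t<m.
          S (take j w) (take j es @ [(fst (es ! j), t)]) *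
          T (drop j w) ((t, snd (es ! j)) # drop (Suc j) es))
     else 0)"

definition gs_const :: "nat \<Rightarrow> 'k::zero mat \<Rightarrow> ('x, 'k) gseries" where
  "gs_const m a = (\<lambda>w es. if w = [] \<and> gs_index m w es then a $$ hd es else 0)"

text \<open>\<open>Y\<^sub>x = 1 Y\<^sub>x 1\<close> is the sum of all \<open>E\<^bsub>pp\<^esub> Y\<^sub>x E\<^bsub>qq\<^esub>\<close>.\<close>

definition gs_letter :: "nat \<Rightarrow> 'x \<Rightarrow> ('x, 'k::zero_neq_one) gseries" where
  "gs_letter m x = (\<lambda>w es.
     if w = [x] \<and> gs_index m w es \<and> (\<forall>(p, q) \<in> set es. p = q) then 1 else 0)"

definition gs_alg :: "nat \<Rightarrow> ('k::field, ('x, 'k) gseries) module" where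
  "gs_alg m = \<lparr>
    carrier = gs_carrier m,
    mult = gs_mult m,
    one = gs_const m (1\<^sub>m m),
    zero = gs_zero,
    add = gs_add,
    smult = gs_smult\<rparr>"

definition gs_component :: "('x, 'k::zero) gseries \<Rightarrow> 'x list \<Rightarrow> ('x, 'k) gseries" where
  "gs_component S w = (\<lambda>v es. if v = w then S v es else 0)"

text \<open>The \<open>\<A>\<close>-bimodule generated by \<open>Y\<^sub>x\<close>, consisting of the finite sums of elements
  \<open>a Y\<^sub>x b\<close>.\<close>

inductive_set gs_bimodule :: "nat \<Rightarrow> 'x \<Rightarrow> ('x, 'k::field) gseries set"
  for m :: nat and x :: 'x where
  zero: "\<zero>\<^bsub>gs_alg m\<^esub> \<in> gs_bimodule m x"
| add: "S \<in> gs_bimodule m x \<Longrightarrow> a \<in> carrier_mat m m \<Longrightarrow> b \<in> carrier_mat m m \<Longrightarrow>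
    S \<oplus>\<^bsub>gs_alg m\<^esub>
      (gs_const m a \<otimes>\<^bsub>gs_alg m\<^esub> gs_letter m x \<otimes>\<^bsub>gs_alg m\<^esub> gs_const m b)
    \<in> gs_bimodule m x"


section \<open>Linear representations and realizations\<close>

text \<open>Rows, columns and matrices of size \<open>n\<close> over \<open>\<A>\<close> or over generalized series are
  functions of indices below \<open>n\<close>; their values at other indices are never used.\<close>

definition linear_representation ::
  "nat \<Rightarrow> nat \<Rightarrow> (nat \<Rightarrow> 'k::field mat) \<Rightarrow> ('x \<Rightarrow> nat \<Rightarrow> nat \<Rightarrow> ('x, 'k) gseries) \<Rightarrow>
   (nat \<Rightarrow> 'k mat) \<Rightarrow> bool" where
  "linear_representation m n c A b \<longleftrightarrow>
     (\<forall>i<n. c i \<in> carrier_mat m m) \<and>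
     (\<forall>x. \<forall>i<n. \<forall>j<n. A x i j \<in> gs_bimodule m x) \<and>
     (\<forall>i<n. b i \<in> carrier_mat m m)"

primrec rep_word ::
  "nat \<Rightarrow> nat \<Rightarrow> ('x \<Rightarrow> nat \<Rightarrow> nat \<Rightarrow> ('x, 'k::field) gseries) \<Rightarrow> 'x list \<Rightarrow>
   nat \<Rightarrow> nat \<Rightarrow> ('x, 'k) gseries" where
  "rep_word m n A [] = (\<lambda>i j. if i = j then \<one>\<^bsub>gs_alg m\<^esub> else \<zero>\<^bsub>gs_alg m\<^esub>)"
| "rep_word m n A (x # w) =
     (\<lambda>i j. \<Oplus>\<^bsub>gs_alg m\<^esub>l\<in>{..<n}. A x i l \<otimes>\<^bsub>gs_alg m\<^esub> rep_word m n A w l j)"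

definition represents ::
  "nat \<Rightarrow> nat \<Rightarrow> (nat \<Rightarrow> 'k::field mat) \<Rightarrow> ('x \<Rightarrow> nat \<Rightarrow> nat \<Rightarrow> ('x, 'k) gseries) \<Rightarrow>
   (nat \<Rightarrow> 'k mat) \<Rightarrow> ('x, 'k) gseries \<Rightarrow> bool" where
  "represents m n c A b S \<longleftrightarrow>
     (\<forall>w. gs_component S w =
       (\<Oplus>\<^bsub>gs_alg m\<^esub>i\<in>{..<n}. \<Oplus>\<^bsub>gs_alg m\<^esub>j\<in>{..<n}.
          gs_const m (c i) \<otimes>\<^bsub>gs_alg m\<^esub> rep_word m n A w i j \<otimes>\<^bsub>gs_alg m\<^esub> gs_const m (b j)))"

text \<open>The tuple \<open>Y + P\<close> over generalized series.\<close>

definition gs_shift :: "nat \<Rightarrow> ('x \<Rightarrow> 'k::field mat) \<Rightarrow> 'x \<Rightarrow> ('x, 'k) gseries" where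
  "gs_shift m P x = gs_letter m x \<oplus>\<^bsub>gs_alg m\<^esub> gs_const m (P x)"

definition realization_about ::
  "nat \<Rightarrow> nat \<Rightarrow> ('x, 'k::field) nc_expr \<Rightarrow> ('x \<Rightarrow> 'k mat) \<Rightarrow> (nat \<Rightarrow> 'k mat) \<Rightarrow>
   ('x \<Rightarrow> nat \<Rightarrow> nat \<Rightarrow> ('x, 'k) gseries) \<Rightarrow> (nat \<Rightarrow> 'k mat) \<Rightarrow> bool" where
  "realization_about m n r P c A b \<longleftrightarrow>
     P \<in> nc_dom r \<inter> mat_tuples m \<and>
     linear_representation m n c A b \<and>
     nc_defined (gs_alg m) (gs_shift m P) r \<and>
     represents m n c A b (nc_eval (gs_alg m) (gs_shift m P) r)"

end

theory Submission
  imports Defs "Jordan_Normal_Form.Determinant" "HOL-Computational_Algebra.Polynomial_FPS"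
begin

text \<open>Let \<open>S = r(Y + P)\<close>. The proof shows that an identity on matrices of size \<open>N\<close> forces \<open>S = 0\<close>, and that
  \<open>S = 0\<close> makes \<open>r\<close> an identity on matrices of every size.

  Both steps look at \<open>r\<close> on a line \<open>\<tau> \<mapsto> P \<otimes> 1 + \<tau> Z\<close> in the matrices of size \<open>m s\<close>. There \<open>r\<close> is a matrix of
  polynomials divided by a polynomial \<open>d\<close>, where \<open>d\<close> is nonzero exactly at the parameters at which \<open>r\<close> is
  defined, and the expansion of this fraction at \<open>0\<close> is the series \<open>S\<close> evaluated at \<open>t Z\<close>
  (\<open>fraction_on_line_exists\<close>). Evaluation at \<open>t Z\<close> is a homomorphism \<open>gs_eval\<close> from generalized series to
  matrices over \<open>k[[t]]\<close>.

  If \<open>r\<close> vanishes on the size \<open>m s\<close>, then on each such line the numerator vanishes at infinitely many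
  parameters, so \<open>S\<close> evaluates to zero at \<open>t Z\<close> for every \<open>Z\<close> of that size. Cutting matrices of size \<open>m s\<close> into
  \<open>m\<^sup>2\<close> blocks turns \<open>S\<close> into an \<open>m \<times> m\<close> matrix of noncommutative series with scalar coefficients
  (\<open>gs_coord\<close>), evaluated at matrices of size \<open>s\<close>. As in the theorem of Amitsur and Levitzki that matrices
  of size \<open>s\<close> satisfy no polynomial identity of degree below \<open>2 s\<close>, a substitution of matrix units along a
  staircase shows that all coefficients of \<open>S\<close> on words of length below \<open>2 s\<close> are zero
  (\<open>coeff_zero_of_vanishing_on_matrices\<close>). On the other hand, in the same coordinates the realization of
  dimension \<open>n\<close> is a scalar linear representation of dimension \<open>m n\<close>, so a nonzero \<open>S\<close> has a nonzero
  coefficient on a word of length below \<open>m n\<close> (\<open>shortest_nonzero_word_length\<close>). Therefore \<open>S = 0\<close> as soon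
  as \<open>2 s \<ge> m n\<close>.

  Finally, if \<open>S = 0\<close>, the numerator vanishes on every line. A tuple \<open>A\<close> of size \<open>s\<close> in the domain of \<open>r\<close> gives
  the tuple \<open>1 \<otimes> A\<close> of size \<open>m s\<close>, and the line from \<open>P \<otimes> 1\<close> to it yields \<open>r(A) = 0\<close>
  (\<open>rational_identity_of_zero_series\<close>).\<close>


section \<open>Products of matrices along words\<close>

definition words :: "'l set \<Rightarrow> nat \<Rightarrow> 'l list set" where
  "words L l = {v. set v \<subseteq> L \<and> length v = l}"

lemma finite_words: "finite L \<Longrightarrow> finite (words L l)"
  unfolding words_def by (rule finite_lists_length_eq)

lemma words_0: "words L 0 = {[]}"
  by (auto simp: words_def)

lemma sum_words_Suc:
  assumes "finite L"
  shows "(\<Sum>v\<in>words L (Suc l). f v) = (\<Sum>x\<in>L. \<Sum>v\<in>words L l. f (x # v))"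
proof -
  have "(\<Sum>v\<in>words L (Suc l). f v) = (\<Sum>(x, v)\<in>L \<times> words L l. f (x # v))"
    by (rule sum.reindex_bij_witness[where i = "\<lambda>(x, v). x # v" and j = "\<lambda>v. (hd v, tl v)"])
       (auto simp: words_def length_Suc_conv)
  then show ?thesis
    by (simp add: sum.cartesian_product)
qed

lemma sum_words_split:
  assumes "j \<le> l"
  shows "(\<Sum>v\<in>words L l. F (take j v) (drop j v)) =
    (\<Sum>u\<in>words L j. \<Sum>v\<in>words L (l - j). F u v)"
proof -
  have "(\<Sum>v\<in>words L l. F (take j v) (drop j v)) =
      (\<Sum>(u, v)\<in>words L j \<times> words L (l - j). F u v)"
    by (rule sum.reindex_bij_witness
          [where i = "\<lambda>(u, v). u @ v" and j = "\<lambda>v. (take j v, drop j v)"])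
       (use assms in \<open>auto simp: words_def dest: in_set_takeD in_set_dropD\<close>)
  then show ?thesis
    by (simp add: sum.cartesian_product)
qed

text \<open>Square matrices are functions of two indices here, so that one product serves for the blocks of a
tuple of matrices and for the matrices of a linear representation.\<close>

primrec word_prod ::
  "nat \<Rightarrow> ('l \<Rightarrow> nat \<Rightarrow> nat \<Rightarrow> 'a::comm_ring_1) \<Rightarrow> 'l list \<Rightarrow> nat \<Rightarrow> nat \<Rightarrow> 'a" where
  "word_prod n M [] a b = (if a = b then 1 else 0)"
| "word_prod n M (x # v) a b = (\<Sum>c<n. M x a c * word_prod n M v c b)"

lemma word_prod_append:
  assumes "a < n"
  shows "word_prod n M (u @ v) a b = (\<Sum>c<n. word_prod n M u a c * word_prod n M v c b)"
  using assms
proof (induction u arbitrary: a)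
  case Nil
  have "(\<Sum>c<n. word_prod n M [] a c * word_prod n M v c b) =
      (\<Sum>c<n. if a = c then word_prod n M v c b else 0)"
    by (intro sum.cong) auto
  then show ?case
    using Nil by simp
next
  case (Cons x u)
  have "word_prod n M ((x # u) @ v) a b =
      (\<Sum>d<n. \<Sum>c<n. M x a d * (word_prod n M u d c * word_prod n M v c b))"
    using Cons.IH by (simp add: sum_distrib_left)
  also have "\<dots> = (\<Sum>c<n. \<Sum>d<n. M x a d * (word_prod n M u d c * word_prod n M v c b))"
    by (rule sum.swap)
  finally show ?case
    by (simp add: sum_distrib_right mult.assoc)
qed

lemma mult_mat_entry:
  assumes "A \<in> carrier_mat n k" and "B \<in> carrier_mat k m" and "i < n" and "j < m"
  shows "(A * B) $$ (i, j) = (\<Sum>l<k. A $$ (i, l) * B $$ (l, j))"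
  using assms by (simp add: scalar_prod_def lessThan_atLeast0)

section \<open>Coefficients seen by small matrices\<close>

text \<open>The index \<open>i\<close> labels the matrix unit with row \<open>i div 2\<close> and column \<open>(i + 1) div 2\<close>. In the order
\<open>E\<^sub>0\<^sub>0, E\<^sub>0\<^sub>1, E\<^sub>1\<^sub>1, E\<^sub>1\<^sub>2, \<dots>\<close> these units form a staircase, and multiplying them in any other order gives
zero. The letter \<open>x\<close> is sent to the sum of the steps \<open>i \<in> I\<close> at which the word \<open>v0\<close> has the
letter \<open>x\<close>.\<close>

definition stair_mat ::
  "'l list \<Rightarrow> nat set \<Rightarrow> 'l \<Rightarrow> nat \<Rightarrow> nat \<Rightarrow> 'a::comm_ring_1" where
  "stair_mat v0 I x a b =
     (\<Sum>i\<in>I. of_bool (v0 ! i = x \<and> a = i div 2 \<and> b = Suc i div 2))"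

text \<open>The list \<open>\<rho>\<close> chooses a step for each letter of \<open>v\<close>. The predicate says that these steps carry the right
letters and that their matrix units compose to the unit from \<open>a\<close> to \<open>b\<close>.\<close>

primrec stair_path :: "'l list \<Rightarrow> nat list \<Rightarrow> 'l list \<Rightarrow> nat \<Rightarrow> nat \<Rightarrow> bool" where
  "stair_path v0 [] v a b \<longleftrightarrow> v = [] \<and> a = b"
| "stair_path v0 (i # \<rho>) v a b \<longleftrightarrow>
     v \<noteq> [] \<and> v0 ! i = hd v \<and> a = i div 2 \<and> stair_path v0 \<rho> (tl v) (Suc i div 2) b"

lemma word_prod_stair_mat:
  assumes "finite I" and "\<And>i. i \<in> I \<Longrightarrow> Suc i div 2 < s"
  shows "word_prod s (stair_mat v0 I) v a b =
    (\<Sum>\<rho>\<in>words I (length v). of_bool (stair_path v0 \<rho> v a b) :: 'a::comm_ring_1)"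
proof (induction v arbitrary: a)
  case Nil
  then show ?case
    by (simp add: words_0)
next
  case (Cons x v)
  let ?P = "\<lambda>i. v0 ! i = x \<and> a = i div 2"
  let ?W = "\<lambda>c. \<Sum>\<rho>\<in>words I (length v). of_bool (stair_path v0 \<rho> v c b) :: 'a"
  have "word_prod s (stair_mat v0 I) (x # v) a b =
      (\<Sum>c<s. \<Sum>i\<in>I. of_bool (?P i \<and> c = Suc i div 2) * ?W c)"
    unfolding word_prod.simps Cons.IH stair_mat_def by (simp only: sum_distrib_right conj_assoc)
  also have "\<dots> = (\<Sum>i\<in>I. \<Sum>c<s. of_bool (?P i \<and> c = Suc i div 2) * ?W c)"
    by (rule sum.swap)
  also have "\<dots> = (\<Sum>i\<in>I. of_bool (?P i) * ?W (Suc i div 2))"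
  proof (rule sum.cong)
    fix i assume "i \<in> I"
    have "(\<Sum>c<s. of_bool (?P i \<and> c = Suc i div 2) * ?W c) =
        (\<Sum>c<s. if c = Suc i div 2 then of_bool (?P i) * ?W c else 0)"
      by (intro sum.cong) auto
    also have "\<dots> = of_bool (?P i) * ?W (Suc i div 2)"
      using assms(2)[OF \<open>i \<in> I\<close>] by simp
    finally show "(\<Sum>c<s. of_bool (?P i \<and> c = Suc i div 2) * ?W c) =
        of_bool (?P i) * ?W (Suc i div 2)" .
  qed simp
  also have "\<dots> = (\<Sum>i\<in>I. \<Sum>\<rho>\<in>words I (length v). of_bool (stair_path v0 (i # \<rho>) (x # v) a b))"
    by (simp add: sum_distrib_left of_bool_conj mult.assoc)
  finally show ?case
    using sum_words_Suc[OF assms(1), of "\<lambda>\<rho>. of_bool (stair_path v0 \<rho> (x # v) a b) :: 'a"]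
    by simp
qed

lemma stair_path_word: "stair_path v0 \<rho> v a b \<Longrightarrow> v = map ((!) v0) \<rho>"
proof (induction \<rho> arbitrary: v a)
  case (Cons i \<rho>)
  then show ?case by (cases v) auto
qed auto

text \<open>A step that follows the step \<open>i\<close> starts where \<open>i\<close> ends, so it is \<open>i\<close> itself (if \<open>i\<close> is a loop), \<open>i + 1\<close>
or \<open>i + 2\<close>. Without repetition the steps go up.\<close>

lemma stair_path_increasing:
  "stair_path v0 \<rho> v a b \<Longrightarrow> distinct \<rho> \<Longrightarrow> sorted_wrt (<) \<rho>"
proof (induction \<rho> arbitrary: v a)
  case (Cons i \<rho>)
  then have s: "sorted_wrt (<) \<rho>" by auto
  show ?case
  proof (cases \<rho>)
    case (Cons j \<sigma>)
    then have "Suc i div 2 = j div 2" "i \<noteq> j"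
      using Cons.prems by auto
    then have "i < j" by presburger
    then show ?thesis using s Cons by auto
  qed simp
qed simp

lemma stair_path_upt:
  "i \<le> length v0 \<Longrightarrow>
   stair_path v0 [i..<length v0] (drop i v0) (i div 2) (length v0 div 2)"
proof (induction "length v0 - i" arbitrary: i)
  case (Suc d)
  then have i: "i < length v0" by simp
  moreover have "stair_path v0 [Suc i..<length v0] (drop (Suc i) v0)
      (Suc i div 2) (length v0 div 2)"
    by (rule Suc.hyps(1)) (use Suc in auto)
  ultimately show ?case
    by (simp add: upt_conv_Cons hd_drop_conv_nth drop_Suc tl_drop)
qed simp

text \<open>Matrices of size \<open>s\<close> detect every coefficient on words of length \<open>l < 2 s\<close>, because the staircase for a
word \<open>v0\<close> of length \<open>l\<close> has \<open>l\<close> steps and \<open>l div 2 + 1 \<le> s\<close> vertices. Expanding the sum at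
\<open>stair_mat v0 I\<close> gives one term for each choice of \<open>l\<close> steps from \<open>I\<close>. Comparing all sets \<open>I\<close> isolates the
choices in which every step occurs (polarization, here over an arbitrary commutative ring); such a
choice is a path only if it is the list \<open>[0..<l]\<close>, which spells \<open>v0\<close>.\<close>

lemma coeff_zero_of_vanishing_on_matrices:
  fixes f :: "'l list \<Rightarrow> 'a::comm_ring_1"
  assumes L: "finite L"
    and vanish: "\<And>M. (\<Sum>v\<in>words L l. f v * word_prod s M v 0 (l div 2)) = 0"
    and l: "l < 2 * s" and v0: "v0 \<in> words L l"
  shows "f v0 = 0"
proof -
  define h where
    "h \<rho> = (\<Sum>v\<in>words L l. f v * of_bool (stair_path v0 \<rho> v 0 (l div 2)))" for \<rho>
  \<comment> \<open>The part of the expansion that uses exactly the steps in \<open>I\<close>.\<close>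
  define g where "g I = (\<Sum>\<rho>\<in>{\<rho>. set \<rho> = I \<and> length \<rho> = l}. h \<rho>)" for I
  have len: "length v0 = l" using v0 by (simp add: words_def)
  have subsets: "(\<Sum>J\<in>Pow I. g J) = 0" if I: "I \<subseteq> {..<l}" for I
  proof -
    have fin: "finite I" using I finite_subset by auto
    have lt: "Suc i div 2 < s" if "i \<in> I" for i
      using that I l by (auto simp: less_mult_imp_div_less)
    have "0 = (\<Sum>v\<in>words L l. f v * word_prod s (stair_mat v0 I) v 0 (l div 2))"
      using vanish by simp
    also have "\<dots> = (\<Sum>v\<in>words L l. \<Sum>\<rho>\<in>words I l.
        f v * of_bool (stair_path v0 \<rho> v 0 (l div 2)))"
      by (intro sum.cong refl)
         (simp add: word_prod_stair_mat[OF fin lt] sum_distrib_left words_def)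
    also have "\<dots> = (\<Sum>\<rho>\<in>words I l. h \<rho>)"
      unfolding h_def by (rule sum.swap)
    also have "words I l = (\<Union>J\<in>Pow I. {\<rho>. set \<rho> = J \<and> length \<rho> = l})"
      by (auto simp: words_def)
    also have "(\<Sum>\<rho>\<in>\<dots>. h \<rho>) = (\<Sum>J\<in>Pow I. g J)"
      unfolding g_def
    proof (rule sum.UNION_disjoint)
      show "\<forall>J\<in>Pow I. finite {\<rho>. set \<rho> = J \<and> length \<rho> = l}"
      proof
        fix J assume "J \<in> Pow I"
        then have "finite (words J l)" using finite_subset[OF _ fin] by (intro finite_words) auto
        then show "finite {\<rho>. set \<rho> = J \<and> length \<rho> = l}"
          by (rule rev_finite_subset) (auto simp: words_def)
      qed
    qed (use fin in auto)
    finally show ?thesis by simp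
  qed
  \<comment> \<open>By induction on \<open>I\<close>: all proper subsets contribute zero to the sum that vanishes.\<close>
  have g0: "g I = 0" if "I \<subseteq> {..<l}" for I
  proof -
    have "finite I" using that finite_subset by auto
    then show ?thesis using that
    proof (induction I rule: finite_psubset_induct)
      case (psubset I)
      have "(\<Sum>J\<in>Pow I. g J) = g I + (\<Sum>J\<in>Pow I - {I}. g J)"
        using psubset.hyps by (intro sum.remove) auto
      also have "(\<Sum>J\<in>Pow I - {I}. g J) = 0"
        using psubset by (intro sum.neutral) auto
      finally show ?case using subsets[OF psubset.prems] by simp
    qed
  qed
  have unique: "\<rho> = [0..<l]" if "set \<rho> = {..<l}" "length \<rho> = l" "stair_path v0 \<rho> v a b"
    for \<rho> v a b
  proof -
    have "distinct \<rho>" using that by (intro card_distinct) simp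
    then have "sorted_wrt (<) \<rho>" using stair_path_increasing that(3) by blast
    then show ?thesis
      using strict_sorted_equal[of \<rho> "[0..<l]"] that(1) by (auto simp: atLeast0LessThan)
  qed
  have path: "stair_path v0 [0..<l] v0 0 (l div 2)"
    using stair_path_upt[of 0 v0] len by simp
  have "g {..<l} = (\<Sum>\<rho>\<in>{[0..<l]}. h \<rho>)"
    unfolding g_def
  proof (rule sum.mono_neutral_right)
    have "finite (words {..<l} l)" by (simp add: finite_words)
    then show "finite {\<rho>. set \<rho> = {..<l} \<and> length \<rho> = l}"
      by (rule rev_finite_subset) (auto simp: words_def)
    show "\<forall>\<rho>\<in>{\<rho>. set \<rho> = {..<l} \<and> length \<rho> = l} - {[0..<l]}. h \<rho> = 0"
    proof
      fix \<rho> assume \<rho>: "\<rho> \<in> {\<rho>. set \<rho> = {..<l} \<and> length \<rho> = l} - {[0..<l]}"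
      then have "\<not> stair_path v0 \<rho> v 0 (l div 2)" for v
        using unique[of \<rho> v 0 "l div 2"] by blast
      then show "h \<rho> = 0"
        by (simp add: h_def)
    qed
  qed auto
  then have "h [0..<l] = 0" using g0[of "{..<l}"] by simp
  moreover have "h [0..<l] = (\<Sum>v\<in>{v0}. f v * of_bool (stair_path v0 [0..<l] v 0 (l div 2)))"
    unfolding h_def
  proof (rule sum.mono_neutral_right)
    show "\<forall>v\<in>words L l - {v0}. f v * of_bool (stair_path v0 [0..<l] v 0 (l div 2)) = 0"
    proof
      fix v assume "v \<in> words L l - {v0}"
      then have "\<not> stair_path v0 [0..<l] v 0 (l div 2)"
        using stair_path_word[of v0 "[0..<l]" v] stair_path_word[OF path] by auto
      then show "f v * of_bool (stair_path v0 [0..<l] v 0 (l div 2)) = 0"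
        by simp
    qed
  qed (use v0 finite_words[OF L] in auto)
  ultimately show ?thesis using path by simp
qed

text \<open>Cut a shortest word \<open>v\<close> with \<open>u \<alpha>\<^sup>v \<beta> \<noteq> 0\<close> at all positions. The rows that come from the prefixes and the
columns that come from the suffixes pair to a triangular matrix: a prefix followed by a suffix that
starts later is a shorter word. The diagonal entries are all \<open>u \<alpha>\<^sup>v \<beta>\<close>, so these rows are linearly
independent, and there are at most \<open>D\<close> of them.\<close>

lemma shortest_nonzero_word_length:
  fixes u \<beta> :: "nat \<Rightarrow> 'a::field" and \<alpha> :: "'l \<Rightarrow> nat \<Rightarrow> nat \<Rightarrow> 'a" and D :: nat
  defines "val \<equiv> \<lambda>w. \<Sum>i<D. \<Sum>j<D. u i * word_prod D \<alpha> w i j * \<beta> j"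
  assumes nz: "val v \<noteq> 0"
    and shorter: "\<And>w. set w \<subseteq> set v \<Longrightarrow> length w < length v \<Longrightarrow> val w = 0"
  shows "length v < D"
proof (rule ccontr)
  assume "\<not> length v < D"
  then have D: "D \<le> length v" by simp
  \<comment> \<open>Filling up with a zero column and a zero row makes both factors square of size \<open>D + 1\<close>.\<close>
  define U where "U = mat (Suc D) (Suc D) (\<lambda>(i, k).
    if k < D then \<Sum>a<D. u a * word_prod D \<alpha> (take i v) a k else 0)"
  define X where "X = mat (Suc D) (Suc D) (\<lambda>(k, j).
    if k < D then \<Sum>b<D. word_prod D \<alpha> (drop j v) k b * \<beta> b else 0)"
  have car: "U \<in> carrier_mat (Suc D) (Suc D)" "X \<in> carrier_mat (Suc D) (Suc D)"
    by (auto simp: U_def X_def)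
  have UX: "(U * X) $$ (i, j) = val (take i v @ drop j v)" if "i < Suc D" "j < Suc D" for i j
  proof -
    have "(U * X) $$ (i, j) = (\<Sum>k<Suc D. U $$ (i, k) * X $$ (k, j))"
      using mult_mat_entry[OF car] that by blast
    also have "\<dots> = (\<Sum>k<D. (\<Sum>a<D. u a * word_prod D \<alpha> (take i v) a k) *
        (\<Sum>b<D. word_prod D \<alpha> (drop j v) k b * \<beta> b))"
      using that by (simp add: U_def X_def)
    also have "\<dots> = (\<Sum>k<D. \<Sum>a<D. \<Sum>b<D. u a * word_prod D \<alpha> (take i v) a k *
        (word_prod D \<alpha> (drop j v) k b * \<beta> b))"
      by (simp add: sum_product)
    also have "\<dots> = (\<Sum>a<D. \<Sum>k<D. \<Sum>b<D. u a * word_prod D \<alpha> (take i v) a k *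
        (word_prod D \<alpha> (drop j v) k b * \<beta> b))"
      by (rule sum.swap)
    also have "\<dots> = (\<Sum>a<D. \<Sum>b<D. \<Sum>k<D. u a * word_prod D \<alpha> (take i v) a k *
        (word_prod D \<alpha> (drop j v) k b * \<beta> b))"
      by (rule sum.cong[OF refl], rule sum.swap)
    also have "\<dots> = val (take i v @ drop j v)"
      unfolding val_def
      by (intro sum.cong refl)
         (simp add: word_prod_append sum_distrib_left sum_distrib_right mult.assoc)
    finally show ?thesis .
  qed
  have "det (U * X) = prod_list (diag_mat (U * X))"
  proof (rule det_lower_triangular)
    fix i j assume ij: "i < j" "j < Suc D"
    have "val (take i v @ drop j v) = 0"
    proof (rule shorter)
      show "set (take i v @ drop j v) \<subseteq> set v"
        using set_take_subset[of i v] set_drop_subset[of j v] by simp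
    qed (use ij D in simp)
    then show "(U * X) $$ (i, j) = 0"
      using ij by (subst UX) simp_all
  qed (rule mult_carrier_mat[OF car])
  also have "\<dots> = (\<Prod>i<Suc D. val v)"
    unfolding prod_list_diag_prod
  proof (rule prod.cong)
    fix i assume "i \<in> {..<Suc D}"
    then show "(U * X) $$ (i, i) = val v"
      by (subst UX) auto
  qed (use car in auto)
  finally have "det (U * X) \<noteq> 0" using nz by simp
  moreover have "det U = 0"
    by (subst laplace_expansion_column[OF car(1), of D]) (auto simp: U_def)
  ultimately show False
    using det_mult[OF car] by simp
qed

section \<open>Evaluation of expressions under homomorphisms\<close>

hide_const (open) Polynomial.smult

text \<open>The part of the axioms of an algebra that makes the evaluation of expressions stay in the carrier.\<close>

locale nc_algebra = ring R for R :: "('k::zero, 'a, 'b) module_scheme" (structure) +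
  assumes smult_closed: "x \<in> carrier R \<Longrightarrow> c \<odot> x \<in> carrier R"
begin

lemma nc_word_eval_closed:
  "(\<And>x. A x \<in> carrier R) \<Longrightarrow> nc_word_eval R A w \<in> carrier R"
  unfolding nc_word_eval_def by (induction w) auto

lemma nc_poly_eval_closed:
  "(\<And>x. A x \<in> carrier R) \<Longrightarrow> nc_poly_eval R A p \<in> carrier R"
  unfolding nc_poly_eval_def
  by (intro finsum_closed) (auto intro: smult_closed nc_word_eval_closed)

lemma nc_eval_closed:
  "(\<And>x. A x \<in> carrier R) \<Longrightarrow> nc_defined R A r \<Longrightarrow> nc_eval R A r \<in> carrier R"
  by (induction r) (auto intro: nc_poly_eval_closed)

end

definition nc_hom ::
  "('k::zero, 'a, 'b) module_scheme \<Rightarrow> ('k, 'c, 'd) module_scheme \<Rightarrow> ('a \<Rightarrow> 'c) \<Rightarrow> bool" where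
  "nc_hom R S \<phi> \<longleftrightarrow>
     (\<forall>x\<in>carrier R. \<phi> x \<in> carrier S) \<and> \<phi> \<zero>\<^bsub>R\<^esub> = \<zero>\<^bsub>S\<^esub> \<and> \<phi> \<one>\<^bsub>R\<^esub> = \<one>\<^bsub>S\<^esub> \<and>
     (\<forall>x\<in>carrier R. \<forall>y\<in>carrier R. \<phi> (x \<oplus>\<^bsub>R\<^esub> y) = \<phi> x \<oplus>\<^bsub>S\<^esub> \<phi> y) \<and>
     (\<forall>x\<in>carrier R. \<forall>y\<in>carrier R. \<phi> (x \<otimes>\<^bsub>R\<^esub> y) = \<phi> x \<otimes>\<^bsub>S\<^esub> \<phi> y) \<and>
     (\<forall>c. \<forall>x\<in>carrier R. \<phi> (c \<odot>\<^bsub>R\<^esub> x) = c \<odot>\<^bsub>S\<^esub> \<phi> x)"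

context
  fixes R :: "('k::zero, 'a, 'b) module_scheme" and S :: "('k, 'c, 'd) module_scheme"
    and \<phi> :: "'a \<Rightarrow> 'c" and A :: "'x \<Rightarrow> 'a"
  assumes R: "nc_algebra R" and S: "nc_algebra S" and hom: "nc_hom R S \<phi>"
    and A: "\<And>x. A x \<in> carrier R"
begin

interpretation R: nc_algebra R by (rule R)
interpretation S: nc_algebra S by (rule S)

lemma nc_hom_closed: "x \<in> carrier R \<Longrightarrow> \<phi> x \<in> carrier S"
  and nc_hom_zero: "\<phi> \<zero>\<^bsub>R\<^esub> = \<zero>\<^bsub>S\<^esub>"
  and nc_hom_one: "\<phi> \<one>\<^bsub>R\<^esub> = \<one>\<^bsub>S\<^esub>"
  and nc_hom_add: "x \<in> carrier R \<Longrightarrow> y \<in> carrier R \<Longrightarrow> \<phi> (x \<oplus>\<^bsub>R\<^esub> y) = \<phi> x \<oplus>\<^bsub>S\<^esub> \<phi> y"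
  and nc_hom_mult: "x \<in> carrier R \<Longrightarrow> y \<in> carrier R \<Longrightarrow> \<phi> (x \<otimes>\<^bsub>R\<^esub> y) = \<phi> x \<otimes>\<^bsub>S\<^esub> \<phi> y"
  and nc_hom_smult: "x \<in> carrier R \<Longrightarrow> \<phi> (c \<odot>\<^bsub>R\<^esub> x) = c \<odot>\<^bsub>S\<^esub> \<phi> x"
  using hom by (auto simp: nc_hom_def)

lemma word_eval_closed: "nc_word_eval R A w \<in> carrier R"
  using A by (rule R.nc_word_eval_closed)

lemma eval_closed: "nc_defined R A r \<Longrightarrow> nc_eval R A r \<in> carrier R"
  using A by (rule R.nc_eval_closed)

lemma nc_word_eval_hom: "\<phi> (nc_word_eval R A w) = nc_word_eval S (\<lambda>x. \<phi> (A x)) w"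
proof (induction w)
  case Nil
  then show ?case by (simp add: nc_word_eval_def nc_hom_one)
next
  case (Cons x w)
  have "\<phi> (A x \<otimes>\<^bsub>R\<^esub> nc_word_eval R A w) = \<phi> (A x) \<otimes>\<^bsub>S\<^esub> \<phi> (nc_word_eval R A w)"
    by (intro nc_hom_mult A word_eval_closed)
  with Cons show ?case by (simp add: nc_word_eval_def)
qed

lemma nc_poly_eval_hom: "\<phi> (nc_poly_eval R A p) = nc_poly_eval S (\<lambda>x. \<phi> (A x)) p"
proof -
  let ?t = "\<lambda>w. Poly_Mapping.lookup p w \<odot>\<^bsub>R\<^esub> nc_word_eval R A w"
  have t: "?t w \<in> carrier R" for w
    by (intro R.smult_closed word_eval_closed)
  have "\<phi> (finsum R ?t K) = finsum S (\<lambda>w. \<phi> (?t w)) K" if "finite K" for K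
    using that
  proof induction
    case empty
    then show ?case by (simp add: nc_hom_zero)
  next
    case (insert w K)
    have "finsum R ?t (insert w K) = ?t w \<oplus>\<^bsub>R\<^esub> finsum R ?t K"
      by (rule R.finsum_insert) (use insert t in auto)
    moreover have "finsum S (\<lambda>w. \<phi> (?t w)) (insert w K) =
        \<phi> (?t w) \<oplus>\<^bsub>S\<^esub> finsum S (\<lambda>w. \<phi> (?t w)) K"
      by (rule S.finsum_insert) (use insert t nc_hom_closed in auto)
    moreover have "finsum R ?t K \<in> carrier R"
      by (rule R.finsum_closed) (use t in auto)
    ultimately show ?case
      using insert.IH t by (simp add: nc_hom_add)
  qed
  then have "\<phi> (nc_poly_eval R A p) = finsum S (\<lambda>w. \<phi> (?t w)) (Poly_Mapping.keys p)"
    by (simp add: nc_poly_eval_def)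
  also have "(\<lambda>w. \<phi> (?t w)) =
      (\<lambda>w. Poly_Mapping.lookup p w \<odot>\<^bsub>S\<^esub> nc_word_eval S (\<lambda>x. \<phi> (A x)) w)"
    by (simp add: word_eval_closed nc_hom_smult nc_word_eval_hom)
  finally show ?thesis by (simp only: nc_poly_eval_def)
qed

text \<open>Homomorphisms preserve inverses, so they can only enlarge the set of expressions that are defined.\<close>

lemma nc_eval_hom:
  "nc_defined R A r \<Longrightarrow>
   nc_defined S (\<lambda>x. \<phi> (A x)) r \<and> nc_eval S (\<lambda>x. \<phi> (A x)) r = \<phi> (nc_eval R A r)"
proof (induction r)
  case (NC_Poly p)
  then show ?case by (simp add: nc_poly_eval_hom)
next
  case (NC_Add r s)
  then show ?case by (simp add: eval_closed nc_hom_add)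
next
  case (NC_Mult r s)
  then show ?case by (simp add: eval_closed nc_hom_mult)
next
  case (NC_Inv r)
  let ?x = "nc_eval R A r"
  have x: "?x \<in> Units R" using NC_Inv.prems by simp
  then have c: "?x \<in> carrier R" "inv\<^bsub>R\<^esub> ?x \<in> carrier R" by auto
  have "\<phi> (inv\<^bsub>R\<^esub> ?x) \<otimes>\<^bsub>S\<^esub> \<phi> ?x = \<one>\<^bsub>S\<^esub>" "\<phi> ?x \<otimes>\<^bsub>S\<^esub> \<phi> (inv\<^bsub>R\<^esub> ?x) = \<one>\<^bsub>S\<^esub>"
    using x c nc_hom_one by (simp_all flip: nc_hom_mult)
  moreover have "\<phi> ?x \<in> carrier S" "\<phi> (inv\<^bsub>R\<^esub> ?x) \<in> carrier S"
    using c nc_hom_closed by auto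
  ultimately have "\<phi> ?x \<in> Units S" "inv\<^bsub>S\<^esub> (\<phi> ?x) = \<phi> (inv\<^bsub>R\<^esub> ?x)"
    by (auto simp: Units_def intro: S.inv_unique'[symmetric])
  then show ?case using NC_Inv by simp
qed

end

text \<open>Matrices over a commutative ring \<open>'a\<close>, as an algebra over \<open>'k\<close> by means of \<open>h\<close>. It provides matrices over
\<open>k\<close>, over \<open>k[t]\<close> and over \<open>k[[t]]\<close> as targets for the same expressions.\<close>

definition mat_alg_via :: "('k \<Rightarrow> 'a::comm_ring_1) \<Rightarrow> nat \<Rightarrow> ('k, 'a mat) module" where
  "mat_alg_via h N = \<lparr>
    carrier = carrier_mat N N,
    mult = (*),
    one = 1\<^sub>m N,
    zero = 0\<^sub>m N N,
    add = (+),
    smult = (\<lambda>c M. h c \<cdot>\<^sub>m M)\<rparr>"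

lemma mat_alg_via_simps [simp]:
  "carrier (mat_alg_via h N) = carrier_mat N N"
  "mult (mat_alg_via h N) = (*)"
  "one (mat_alg_via h N) = 1\<^sub>m N"
  "zero (mat_alg_via h N) = 0\<^sub>m N N"
  "add (mat_alg_via h N) = (+)"
  "smult (mat_alg_via h N) = (\<lambda>c M. h c \<cdot>\<^sub>m M)"
  by (simp_all add: mat_alg_via_def)

lemma mat_alg_eq_via: "mat_alg N = mat_alg_via (\<lambda>c. c) N"
  by (simp add: module_mat_def mat_alg_via_def)

lemma nc_algebra_mat_alg_via: "nc_algebra (mat_alg_via h N)"
  by unfold_locales
     (insert add_inv_exists_mat, auto simp: mat_alg_via_def algebra_simps Units_def)

lemma nc_hom_map_mat:
  assumes "comm_ring_hom \<psi>" and "\<And>c. \<psi> (h c) = h' c"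
  shows "nc_hom (mat_alg_via h N) (mat_alg_via h' N) (map_mat \<psi>)"
proof -
  interpret comm_ring_hom \<psi> by fact
  show ?thesis
    unfolding nc_hom_def mat_alg_via_simps
    by (auto simp: mat_hom_one mat_hom_mult assms(2) hom_distribs intro!: eq_matI)
qed

lemma Units_mat_alg_iff:
  assumes "X \<in> carrier_mat N N"
  shows "X \<in> Units (mat_alg N :: ('k::field, 'k mat) module) \<longleftrightarrow> det X \<noteq> 0"
proof -
  have "Units (mat_alg N :: ('k, 'k mat) module) = Units (ring_mat TYPE('k) N ())"
    by (simp add: Units_def module_mat_def ring_mat_def)
  then show ?thesis
    using det_non_zero_imp_unit[OF assms, of "()"] unit_imp_det_non_zero[of X N "()"] by auto
qed

section \<open>Generalized series as matrices of series in scalar letters\<close>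

lemma sum_lessThan_mult:
  fixes h :: "nat \<Rightarrow> 'a::comm_monoid_add"
  shows "(\<Sum>k<m * s. h k) = (\<Sum>t<m. \<Sum>c<s. h (t * s + c))"
proof -
  have "sum h {t * s..<t * s + s} = (\<Sum>c<s. h (t * s + c))" for t
    using sum.shift_bounds_nat_ivl[of h 0 "t * s" s] by (simp add: add.commute atLeast0LessThan)
  then show ?thesis by (simp flip: sum.nat_group)
qed

lemma block_index_less: "p < m \<Longrightarrow> a < s \<Longrightarrow> p * s + a < m * (s::nat)"
  using mult_le_mono1[of "Suc p" m s] by simp

text \<open>Write \<open>Y\<^sub>x = \<Sum> E\<^bsub>qp\<^esub> y\<^bsub>(x,q,p)\<^esub>\<close> with letters \<open>y\<^bsub>(x,q,p)\<^esub>\<close> that commute with \<open>M\<^sub>m(k)\<close>. The basis element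
\<open>E\<^bsub>p\<^sub>0q\<^sub>0\<^esub> w\<^sub>1 E\<^bsub>p\<^sub>1q\<^sub>1\<^esub> w\<^sub>2 \<dots> w\<^sub>l E\<^bsub>p\<^sub>lq\<^sub>l\<^esub>\<close> becomes the matrix unit \<open>E\<^bsub>p\<^sub>0q\<^sub>l\<^esub>\<close> times the word in the letters
\<open>(w\<^sub>i, q\<^bsub>i-1\<^esub>, p\<^sub>i)\<close>, and a generalized series becomes an \<open>m \<times> m\<close> matrix of noncommutative
series with scalar coefficients. Its entry \<open>(p, q)\<close> has the coefficient \<open>gs_coord S p q v\<close> on the word \<open>v\<close>.\<close>

definition gs_coord ::
  "('x, 'k) gseries \<Rightarrow> nat \<Rightarrow> nat \<Rightarrow> ('x \<times> nat \<times> nat) list \<Rightarrow> 'k" where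
  "gs_coord S p q v =
     S (map fst v) (zip (p # map (\<lambda>y. snd (snd y)) v) (map (\<lambda>y. fst (snd y)) v @ [q]))"

definition gs_letters :: "nat \<Rightarrow> ('x \<times> nat \<times> nat) set" where
  "gs_letters m = UNIV \<times> {..<m} \<times> {..<m}"

lemma finite_gs_letters: "finite (gs_letters m :: ('x::finite \<times> nat \<times> nat) set)"
  by (simp add: gs_letters_def)

lemma gs_index_coord:
  assumes "p < m" "q < m" "set v \<subseteq> gs_letters m"
  shows "gs_index m (map fst v)
    (zip (p # map (\<lambda>y. snd (snd y)) v) (map (\<lambda>y. fst (snd y)) v @ [q]))"
  using assms
  by (fastforce simp: gs_index_def gs_letters_def dest: set_zip_leftD set_zip_rightD)

lemma gs_coord_zero [simp]: "gs_coord gs_zero p q v = 0"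
  by (simp add: gs_coord_def gs_zero_def)

lemma gs_coord_add: "gs_coord (gs_add S T) p q v = gs_coord S p q v + gs_coord T p q v"
  by (simp add: gs_coord_def gs_add_def)

lemma gs_coord_smult: "gs_coord (gs_smult c S) p q v = c * gs_coord S p q v"
  by (simp add: gs_coord_def gs_smult_def)

lemma gs_coord_const:
  assumes "p < m" "q < m"
  shows "gs_coord (gs_const m a) p q v = (if v = [] then a $$ (p, q) else 0)"
  using assms by (simp add: gs_coord_def gs_const_def gs_index_def)

lemma gs_coord_letter:
  assumes "p < m" "q < m" "set v \<subseteq> gs_letters m"
  shows "gs_coord (gs_letter m x) p q v = (if v = [(x, p, q)] then 1 else 0)"
proof (cases "\<exists>y q' p'. v = [(y, q', p')]")
  case True
  then show ?thesis
    using gs_index_coord[OF assms] by (auto simp: gs_coord_def gs_letter_def)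
next
  case False
  then have "length v \<noteq> 1"
    by (metis One_nat_def length_0_conv length_Suc_conv prod_cases3)
  then have "map fst v \<noteq> [x]"
    by (metis length_Cons length_map list.size(3) One_nat_def)
  then show ?thesis
    using False by (auto simp: gs_coord_def gs_letter_def)
qed

text \<open>In the coordinates the multiplication is the usual one: matrix product and concatenation of words.\<close>

lemma gs_coord_mult:
  assumes "p < m" "q < m" "set v \<subseteq> gs_letters m"
  shows "gs_coord (gs_mult m S T) p q v =
    (\<Sum>j\<le>length v. \<Sum>t<m. gs_coord S p t (take j v) * gs_coord T t q (drop j v))"
proof -
  define P where "P = p # map (\<lambda>y. snd (snd y)) v"
  define Q where "Q = map (\<lambda>y. fst (snd y)) v @ [q]"
  have len: "length P = Suc (length v)" "length Q = Suc (length v)"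
    by (simp_all add: P_def Q_def)
  have left: "S (take j (map fst v)) (take j (zip P Q) @ [(fst (zip P Q ! j), t)]) =
      gs_coord S p t (take j v)" if "j \<le> length v" for j t
  proof -
    have "take j (zip P Q) @ [(fst (zip P Q ! j), t)] = zip (take (Suc j) P) (take j Q @ [t])"
      using that len by (simp add: take_Suc_conv_app_nth take_zip)
    also have "take (Suc j) P = p # map (\<lambda>y. snd (snd y)) (take j v)"
      by (simp add: P_def take_map)
    also have "take j Q = map (\<lambda>y. fst (snd y)) (take j v)"
      using that by (simp add: Q_def take_map)
    finally show ?thesis by (simp add: gs_coord_def take_map)
  qed
  have right: "T (drop j (map fst v)) ((t, snd (zip P Q ! j)) # drop (Suc j) (zip P Q)) =
      gs_coord T t q (drop j v)" if "j \<le> length v" for j t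
  proof -
    have "(t, snd (zip P Q ! j)) # drop (Suc j) (zip P Q) = zip (t # drop (Suc j) P) (drop j Q)"
      using that len by (simp add: drop_zip Cons_nth_drop_Suc[symmetric])
    also have "drop (Suc j) P = map (\<lambda>y. snd (snd y)) (drop j v)"
      by (simp add: P_def drop_map)
    also have "drop j Q = map (\<lambda>y. fst (snd y)) (drop j v) @ [q]"
      using that by (simp add: Q_def drop_map)
    finally show ?thesis by (simp add: gs_coord_def drop_map)
  qed
  have "gs_coord (gs_mult m S T) p q v = gs_mult m S T (map fst v) (zip P Q)"
    by (simp add: gs_coord_def P_def Q_def)
  also have "\<dots> = (\<Sum>j\<le>length v. \<Sum>t<m. gs_coord S p t (take j v) * gs_coord T t q (drop j v))"
    using gs_index_coord[OF assms] left right by (simp add: gs_mult_def P_def Q_def)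
  finally show ?thesis .
qed

lemma gs_eq_of_coord:
  assumes S: "S \<in> gs_carrier m" and T: "T \<in> gs_carrier m"
    and eq: "\<And>p q v. p < m \<Longrightarrow> q < m \<Longrightarrow> set v \<subseteq> gs_letters m \<Longrightarrow> gs_coord S p q v = gs_coord T p q v"
  shows "S = T"
proof (intro ext)
  fix w es
  show "S w es = T w es"
  proof (cases "gs_index m w es")
    case True
    define P where "P = map fst es"
    define Q where "Q = map snd es"
    define v where "v = zip w (zip (butlast Q) (tl P))"
    have len: "length P = Suc (length w)" "length Q = Suc (length w)"
      using True by (auto simp: gs_index_def P_def Q_def)
    have es: "es = zip P Q" by (simp add: P_def Q_def zip_map_fst_snd)
    have ne: "P \<noteq> []" "Q \<noteq> []" using len by auto
    have v: "map fst v = w" "map (\<lambda>y. fst (snd y)) v = butlast Q" "map (\<lambda>y. snd (snd y)) v = tl P"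
      using len by (auto simp: v_def intro!: nth_equalityI)
    have PQ: "set P \<subseteq> {..<m}" "set Q \<subseteq> {..<m}"
      using True by (auto simp: gs_index_def P_def Q_def)
    have "gs_coord S (hd P) (last Q) v = gs_coord T (hd P) (last Q) v"
    proof (rule eq)
      show "hd P < m" using PQ hd_in_set[OF ne(1)] by blast
      show "last Q < m" using PQ last_in_set[OF ne(2)] by blast
      show "set v \<subseteq> gs_letters m"
      proof
        fix y assume "y \<in> set v"
        then have "snd y \<in> set (zip (butlast Q) (tl P))"
          unfolding v_def by (metis prod.collapse set_zip_rightD)
        then have "fst (snd y) \<in> set (butlast Q)" "snd (snd y) \<in> set (tl P)"
          by (metis prod.collapse set_zip_leftD, metis prod.collapse set_zip_rightD)
        then show "y \<in> gs_letters m"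
          using PQ by (cases y) (auto simp: gs_letters_def dest: in_set_butlastD list.set_sel(2)[OF ne(1)])
      qed
    qed
    then show ?thesis
      using ne by (simp add: gs_coord_def v es)
  next
    case False
    then show ?thesis using S T by (simp add: gs_carrier_def)
  qed
qed

section \<open>Evaluation of series at matrices\<close>

text \<open>An index below \<open>m * s\<close> is a pair of an index below \<open>m\<close> (the quotient by \<open>s\<close>) and one below \<open>s\<close> (the
remainder). The letter \<open>(x, q, p)\<close> is sent to the block \<open>(q, p)\<close> of the matrix \<open>Z x\<close>.\<close>

definition mat_block :: "nat \<Rightarrow> ('x \<Rightarrow> 'k mat) \<Rightarrow> 'x \<times> nat \<times> nat \<Rightarrow> nat \<Rightarrow> nat \<Rightarrow> 'k" where
  "mat_block s Z = (\<lambda>(x, q, p) a b. Z x $$ (q * s + a, p * s + b))"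

text \<open>The value of \<open>S\<close> at \<open>t Z\<close>, where \<open>t\<close> is a formal parameter. The coefficient of \<open>t\<^sup>l\<close> is
the finite sum over the words of length \<open>l\<close>, so there is no question of convergence.\<close>

definition gs_eval ::
  "nat \<Rightarrow> nat \<Rightarrow> ('x::finite \<Rightarrow> 'k::field mat) \<Rightarrow> ('x, 'k) gseries \<Rightarrow> 'k fps mat" where
  "gs_eval m s Z S = mat (m * s) (m * s) (\<lambda>(i, j). Abs_fps (\<lambda>l.
     \<Sum>v\<in>words (gs_letters m) l. gs_coord S (i div s) (j div s) v *
       word_prod s (mat_block s Z) v (i mod s) (j mod s)))"

lemma gs_eval_carrier [simp]: "gs_eval m s Z S \<in> carrier_mat (m * s) (m * s)"
  by (simp add: gs_eval_def)

lemma dim_gs_eval [simp]: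
  "dim_row (gs_eval m s Z S) = m * s" "dim_col (gs_eval m s Z S) = m * s"
  by (simp_all add: gs_eval_def)

lemma gs_eval_nth:
  assumes "i < m * s" "j < m * s"
  shows "fps_nth (gs_eval m s Z S $$ (i, j)) l =
    (\<Sum>v\<in>words (gs_letters m) l. gs_coord S (i div s) (j div s) v *
       word_prod s (mat_block s Z) v (i mod s) (j mod s))"
  using assms by (simp add: gs_eval_def)

lemma gs_eval_zero: "gs_eval m s Z gs_zero = 0\<^sub>m (m * s) (m * s)"
  by (rule eq_matI) (auto simp: gs_eval_def fps_eq_iff)

lemma gs_eval_add: "gs_eval m s Z (gs_add S T) = gs_eval m s Z S + gs_eval m s Z T"
  by (rule eq_matI)
     (auto simp: gs_eval_def fps_eq_iff gs_coord_add sum.distrib distrib_right)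

lemma gs_eval_smult: "gs_eval m s Z (gs_smult c S) = fps_const c \<cdot>\<^sub>m gs_eval m s Z S"
  by (rule eq_matI)
     (auto simp: gs_eval_def fps_eq_iff gs_coord_smult sum_distrib_left mult.assoc)

lemma block_index_bounds:
  assumes "i < m * (s::nat)"
  shows "i div s < m" "i mod s < s"
  using assms by (auto simp: less_mult_imp_div_less intro!: mod_less_divisor gr0I)

lemma sum_words_short:
  fixes f :: "('x::finite \<times> nat \<times> nat) list \<Rightarrow> 'a::comm_monoid_add"
  shows "(\<Sum>v\<in>words L l. if v = [] then f v else 0) = (if l = 0 then f [] else 0)"
proof (cases "l = 0")
  case False
  then show ?thesis by (auto simp: words_def intro!: sum.neutral)
qed (simp add: words_0)

lemma gs_eval_const:
  "gs_eval m s Z (gs_const m a) = mat (m * s) (m * s) (\<lambda>(i, j).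
     if i mod s = j mod s then fps_const (a $$ (i div s, j div s)) else 0)"
proof (rule eq_matI)
  fix i j
  assume "i < dim_row (mat (m * s) (m * s) (\<lambda>(i, j).
      if i mod s = j mod s then fps_const (a $$ (i div s, j div s)) else 0))"
    "j < dim_col (mat (m * s) (m * s) (\<lambda>(i, j).
      if i mod s = j mod s then fps_const (a $$ (i div s, j div s)) else 0))"
  then have ij: "i < m * s" "j < m * s" by auto
  have "fps_nth (gs_eval m s Z (gs_const m a) $$ (i, j)) l =
      (\<Sum>v\<in>words (gs_letters m) l. if v = [] then a $$ (i div s, j div s) *
         word_prod s (mat_block s Z) v (i mod s) (j mod s) else 0)" for l
    unfolding gs_eval_nth[OF ij] using block_index_bounds ij
    by (intro sum.cong) (auto simp: gs_coord_const)
  then show "gs_eval m s Z (gs_const m a) $$ (i, j) = mat (m * s) (m * s) (\<lambda>(i, j).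
      if i mod s = j mod s then fps_const (a $$ (i div s, j div s)) else 0) $$ (i, j)"
    using ij by (auto simp: fps_eq_iff sum_words_short)
qed auto

lemma gs_eval_one:
  fixes Z :: "'x::finite \<Rightarrow> 'k::field mat"
  shows "gs_eval m s Z (gs_const m (1\<^sub>m m)) = 1\<^sub>m (m * s)"
proof (rule eq_matI)
  fix i j assume "i < dim_row (1\<^sub>m (m * s) :: 'k fps mat)" "j < dim_col (1\<^sub>m (m * s) :: 'k fps mat)"
  then have ij: "i < m * s" "j < m * s" by auto
  have "i = j \<longleftrightarrow> i div s = j div s \<and> i mod s = j mod s"
    by (metis div_mult_mod_eq)
  then show "gs_eval m s Z (gs_const m (1\<^sub>m m)) $$ (i, j) = (1\<^sub>m (m * s) :: 'k fps mat) $$ (i, j)"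
    using ij block_index_bounds[OF ij(1)] block_index_bounds[OF ij(2)]
    by (simp add: gs_eval_const)
qed (auto simp: gs_eval_const)

lemma gs_eval_letter:
  "gs_eval m s Z (gs_letter m x) = mat (m * s) (m * s) (\<lambda>(i, j). fps_const (Z x $$ (i, j)) * fps_X)"
proof (rule eq_matI)
  let ?R = "mat (m * s) (m * s) (\<lambda>(i, j). fps_const (Z x $$ (i, j)) * fps_X)"
  fix i j assume "i < dim_row ?R" "j < dim_col ?R"
  then have ij: "i < m * s" "j < m * s" by auto
  note b = block_index_bounds[OF ij(1)] block_index_bounds[OF ij(2)]
  let ?v = "[(x, i div s, j div s)]"
  have "fps_nth (gs_eval m s Z (gs_letter m x) $$ (i, j)) l =
      (\<Sum>v\<in>words (gs_letters m) l. if v = ?v then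
         word_prod s (mat_block s Z) ?v (i mod s) (j mod s) else 0)" for l
    unfolding gs_eval_nth[OF ij] using b
    by (intro sum.cong) (auto simp: gs_coord_letter words_def)
  then have "fps_nth (gs_eval m s Z (gs_letter m x) $$ (i, j)) l =
      (if ?v \<in> words (gs_letters m) l then
         word_prod s (mat_block s Z) ?v (i mod s) (j mod s) else 0)" for l
    by (simp only: sum.delta finite_words[OF finite_gs_letters])
  moreover have "word_prod s (mat_block s Z) ?v (i mod s) (j mod s) = Z x $$ (i, j)"
    using b by (simp add: mat_block_def if_distrib cong: if_cong)
  moreover have "?v \<in> words (gs_letters m) l \<longleftrightarrow> l = 1" for l
    using b by (auto simp: words_def gs_letters_def)
  ultimately show "gs_eval m s Z (gs_letter m x) $$ (i, j) = ?R $$ (i, j)"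
    using ij by (simp add: fps_eq_iff)
qed auto

text \<open>Splitting a word after \<open>n\<close> letters corresponds to the term \<open>t\<^sup>n t\<^bsup>l-n\<^esup>\<close> of a product of power series.\<close>

lemma gs_eval_mult:
  fixes S T :: "('x::finite, 'k::field) gseries"
  shows "gs_eval m s Z (gs_mult m S T) = gs_eval m s Z S * gs_eval m s Z T"
proof (rule eq_matI)
  fix i j
  assume "i < dim_row (gs_eval m s Z S * gs_eval m s Z T)"
    "j < dim_col (gs_eval m s Z S * gs_eval m s Z T)"
  then have ij: "i < m * s" "j < m * s" by (auto simp: gs_eval_def)
  note b = block_index_bounds[OF ij(1)] block_index_bounds[OF ij(2)]
  define W where "W = word_prod s (mat_block s Z)"
  define p a q b where "p = i div s" and "a = i mod s" and "q = j div s" and "b = j mod s"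
  let ?L = "gs_letters m :: ('x \<times> nat \<times> nat) set"
  let ?F = "\<lambda>t c u. gs_coord S p t u * W u a c"
  let ?G = "\<lambda>t c u. gs_coord T t q u * W u c b"
  have "fps_nth ((gs_eval m s Z S * gs_eval m s Z T) $$ (i, j)) l =
      fps_nth (gs_eval m s Z (gs_mult m S T) $$ (i, j)) l" for l
  proof -
    have "fps_nth (gs_eval m s Z (gs_mult m S T) $$ (i, j)) l =
        (\<Sum>v\<in>words ?L l. (\<Sum>n\<le>l. \<Sum>t<m. gs_coord S p t (take n v) * gs_coord T t q (drop n v)) *
          W v a b)"
      unfolding gs_eval_nth[OF ij] W_def using b
      by (intro sum.cong) (auto simp: gs_coord_mult words_def p_def q_def a_def b_def)
    also have "\<dots> = (\<Sum>v\<in>words ?L l. \<Sum>n\<le>l. \<Sum>t<m. \<Sum>c<s. ?F t c (take n v) * ?G t c (drop n v))"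
    proof (rule sum.cong[OF refl])
      fix v
      have W: "W v a b = (\<Sum>c<s. W (take n v) a c * W (drop n v) c b)" for n
        using word_prod_append[of a s "mat_block s Z" "take n v" "drop n v" b] b
        by (simp add: W_def a_def)
      have "(\<Sum>n\<le>l. \<Sum>t<m. gs_coord S p t (take n v) * gs_coord T t q (drop n v)) * W v a b =
          (\<Sum>n\<le>l. \<Sum>t<m. gs_coord S p t (take n v) * gs_coord T t q (drop n v) * W v a b)"
        by (simp add: sum_distrib_right)
      also have "\<dots> = (\<Sum>n\<le>l. \<Sum>t<m. \<Sum>c<s. ?F t c (take n v) * ?G t c (drop n v))"
      proof (intro sum.cong refl)
        fix n t
        show "gs_coord S p t (take n v) * gs_coord T t q (drop n v) * W v a b =
            (\<Sum>c<s. ?F t c (take n v) * ?G t c (drop n v))"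
          unfolding W[of n] by (simp add: sum_distrib_left mult_ac)
      qed
      finally show "(\<Sum>n\<le>l. \<Sum>t<m. gs_coord S p t (take n v) * gs_coord T t q (drop n v)) * W v a b =
          (\<Sum>n\<le>l. \<Sum>t<m. \<Sum>c<s. ?F t c (take n v) * ?G t c (drop n v))" .
    qed
    also have "\<dots> = (\<Sum>n\<le>l. \<Sum>v\<in>words ?L l. \<Sum>t<m. \<Sum>c<s. ?F t c (take n v) * ?G t c (drop n v))"
      by (rule sum.swap)
    also have "\<dots> = (\<Sum>n\<le>l. \<Sum>t<m. \<Sum>c<s.
        (\<Sum>u\<in>words ?L n. ?F t c u) * (\<Sum>v\<in>words ?L (l - n). ?G t c v))"
    proof (rule sum.cong[OF refl])
      fix n assume "n \<in> {..l}"
      then have n: "n \<le> l" by simp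
      have "(\<Sum>v\<in>words ?L l. \<Sum>t<m. \<Sum>c<s. ?F t c (take n v) * ?G t c (drop n v)) =
          (\<Sum>t<m. \<Sum>v\<in>words ?L l. \<Sum>c<s. ?F t c (take n v) * ?G t c (drop n v))"
        by (rule sum.swap)
      also have "\<dots> = (\<Sum>t<m. \<Sum>c<s. \<Sum>v\<in>words ?L l. ?F t c (take n v) * ?G t c (drop n v))"
        by (rule sum.cong[OF refl], rule sum.swap)
      also have "\<dots> = (\<Sum>t<m. \<Sum>c<s.
          (\<Sum>u\<in>words ?L n. ?F t c u) * (\<Sum>v\<in>words ?L (l - n). ?G t c v))"
        by (rule sum.cong[OF refl], rule sum.cong[OF refl])
           (simp only: sum_words_split[OF n, of "\<lambda>u v. ?F _ _ u * ?G _ _ v"] sum_product)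
      finally show "(\<Sum>v\<in>words ?L l. \<Sum>t<m. \<Sum>c<s. ?F t c (take n v) * ?G t c (drop n v)) =
          (\<Sum>t<m. \<Sum>c<s. (\<Sum>u\<in>words ?L n. ?F t c u) * (\<Sum>v\<in>words ?L (l - n). ?G t c v))" .
    qed
    also have "\<dots> = (\<Sum>n\<le>l. \<Sum>k<m * s. fps_nth (gs_eval m s Z S $$ (i, k)) n *
        fps_nth (gs_eval m s Z T $$ (k, j)) (l - n))"
      unfolding sum_lessThan_mult using ij
      by (intro sum.cong refl)
         (simp add: gs_eval_nth block_index_less W_def p_def q_def a_def b_def)
    also have "\<dots> = (\<Sum>k<m * s. \<Sum>n\<le>l. fps_nth (gs_eval m s Z S $$ (i, k)) n *
        fps_nth (gs_eval m s Z T $$ (k, j)) (l - n))"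
      by (rule sum.swap)
    also have "\<dots> = fps_nth (\<Sum>k<m * s. gs_eval m s Z S $$ (i, k) * gs_eval m s Z T $$ (k, j)) l"
      by (simp add: fps_sum_nth fps_mult_nth atMost_atLeast0)
    also have "\<dots> = fps_nth ((gs_eval m s Z S * gs_eval m s Z T) $$ (i, j)) l"
      using mult_mat_entry[OF gs_eval_carrier gs_eval_carrier ij, of Z S Z T] by simp
    finally show ?thesis by simp
  qed
  then show "gs_eval m s Z (gs_mult m S T) $$ (i, j) = (gs_eval m s Z S * gs_eval m s Z T) $$ (i, j)"
    by (simp add: fps_eq_iff)
qed (auto simp: gs_eval_def)

lemma word_prod_cong:
  assumes "\<And>y a b. y \<in> set v \<Longrightarrow> a < s \<Longrightarrow> b < s \<Longrightarrow> M y a b = M' y a b" and "a < s" and "b < s"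
  shows "word_prod s M v a b = word_prod s M' v a b"
  using assms by (induction v arbitrary: a) auto

text \<open>The blocks of \<open>Z\<close> can be prescribed independently, so matrices of size \<open>m s\<close> determine all coefficients
on words of length less than \<open>2 s\<close>.\<close>

lemma gs_coord_eq_of_eval:
  fixes S T :: "('x::finite, 'k::field) gseries"
  assumes eq: "\<And>Z i j. Z \<in> mat_tuples (m * s) \<Longrightarrow> i < m * s \<Longrightarrow> j < m * s \<Longrightarrow>
      fps_nth (gs_eval m s Z S $$ (i, j)) l = fps_nth (gs_eval m s Z T $$ (i, j)) l"
    and l: "l < 2 * s" and pq: "p < m" "q < m" and v: "v \<in> words (gs_letters m) l"
  shows "gs_coord S p q v = gs_coord T p q v"
proof -
  have "gs_coord S p q v - gs_coord T p q v = 0"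
  proof (rule coeff_zero_of_vanishing_on_matrices[OF finite_gs_letters _ l v])
    fix M :: "'x \<times> nat \<times> nat \<Rightarrow> nat \<Rightarrow> nat \<Rightarrow> 'k"
    let ?L = "gs_letters m :: ('x \<times> nat \<times> nat) set"
    define Z where "Z x = mat (m * s) (m * s)
      (\<lambda>(i, j). M (x, i div s, j div s) (i mod s) (j mod s))" for x
    have Z: "Z \<in> mat_tuples (m * s)" by (simp add: mat_tuples_def Z_def)
    have ls: "l div 2 < s" "0 < s" using l by auto
    have wp: "word_prod s (mat_block s Z) u 0 (l div 2) = word_prod s M u 0 (l div 2)"
      if "u \<in> words ?L l" for u
    proof (rule word_prod_cong)
      fix y a b assume y: "y \<in> set u" and ab: "a < s" "b < s"
      obtain x q' p' where "y = (x, q', p')" by (cases y)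
      then show "mat_block s Z y a b = M y a b"
        using y that ab by (auto simp: mat_block_def Z_def words_def gs_letters_def block_index_less)
    qed (use ls in auto)
    have ij: "p * s + 0 < m * s" "q * s + l div 2 < m * s"
      using pq ls by (simp_all only: block_index_less)
    have "(\<Sum>u\<in>words ?L l. gs_coord S p q u * word_prod s M u 0 (l div 2)) =
        fps_nth (gs_eval m s Z S $$ (p * s + 0, q * s + l div 2)) l"
      unfolding gs_eval_nth[OF ij] using ls wp by (intro sum.cong) auto
    also have "\<dots> = fps_nth (gs_eval m s Z T $$ (p * s + 0, q * s + l div 2)) l"
      by (rule eq[OF Z ij])
    also have "\<dots> = (\<Sum>u\<in>words ?L l. gs_coord T p q u * word_prod s M u 0 (l div 2))"
      unfolding gs_eval_nth[OF ij] using ls wp by (intro sum.cong) auto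
    finally show "(\<Sum>u\<in>words ?L l. (gs_coord S p q u - gs_coord T p q u) *
        word_prod s M u 0 (l div 2)) = 0"
      by (simp add: left_diff_distrib sum_subtractf)
  qed
  then show ?thesis by simp
qed

lemma gs_eqI:
  fixes S T :: "('x::finite, 'k::field) gseries"
  assumes "S \<in> gs_carrier m" "T \<in> gs_carrier m"
    and eq: "\<And>s Z. gs_eval m s Z S = gs_eval m s Z T"
  shows "S = T"
  using assms(1,2)
proof (rule gs_eq_of_coord)
  fix p q and v :: "('x \<times> nat \<times> nat) list" assume "p < m" "q < m" and v: "set v \<subseteq> gs_letters m"
  then show "gs_coord S p q v = gs_coord T p q v"
    by (intro gs_coord_eq_of_eval[where s = "Suc (length v)" and l = "length v"])
       (simp_all add: eq words_def)
qed

lemma gs_closed: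
  "gs_zero \<in> gs_carrier m"
  "S \<in> gs_carrier m \<Longrightarrow> T \<in> gs_carrier m \<Longrightarrow> gs_add S T \<in> gs_carrier m"
  "S \<in> gs_carrier m \<Longrightarrow> gs_smult c S \<in> gs_carrier m"
  "gs_mult m S T \<in> gs_carrier m"
  "gs_const m a \<in> gs_carrier m"
  "gs_letter m x \<in> gs_carrier m"
  for S T :: "('x, 'k::field) gseries"
  by (simp_all add: gs_carrier_def gs_zero_def gs_add_def gs_smult_def gs_mult_def gs_const_def
      gs_letter_def)

lemma gs_alg_simps [simp]:
  "carrier (gs_alg m) = gs_carrier m"
  "mult (gs_alg m) = gs_mult m"
  "one (gs_alg m) = gs_const m (1\<^sub>m m)"
  "zero (gs_alg m) = gs_zero"
  "add (gs_alg m) = gs_add"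
  "smult (gs_alg m) = gs_smult"
  by (simp_all add: gs_alg_def)

lemmas gs_eval_hom_simps = gs_eval_zero gs_eval_add gs_eval_smult gs_eval_one gs_eval_mult

lemma gs_mat_assoc:
  "gs_eval m s Z S * gs_eval m s Z T * gs_eval m s Z U =
   gs_eval m s Z S * (gs_eval m s Z T * gs_eval m s Z U)"
  by (rule assoc_mult_mat[OF gs_eval_carrier gs_eval_carrier gs_eval_carrier])

text \<open>The ring laws hold for matrices over power series, and evaluations at matrices of all sizes separate
generalized series.\<close>

lemma nc_algebra_gs_alg: "nc_algebra (gs_alg m :: ('k::field, ('x::finite, 'k) gseries) module)"
proof -
  let ?R = "gs_alg m :: ('k, ('x, 'k) gseries) module"
  have group: "abelian_group ?R"
  proof (rule abelian_groupI)
    fix S assume S: "S \<in> carrier ?R"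
    have "gs_add (gs_smult (-1) S) S = gs_zero"
      by (simp add: gs_add_def gs_smult_def gs_zero_def)
    then show "\<exists>T\<in>carrier ?R. T \<oplus>\<^bsub>?R\<^esub> S = \<zero>\<^bsub>?R\<^esub>"
      using S gs_closed(3)[of S m "-1"] by auto
  qed (auto simp: gs_closed, auto simp: gs_add_def gs_zero_def fun_eq_iff)
  have monoid: "monoid ?R"
  proof (rule monoidI)
    fix S T U assume "S \<in> carrier ?R" "T \<in> carrier ?R" "U \<in> carrier ?R"
    show "S \<otimes>\<^bsub>?R\<^esub> T \<otimes>\<^bsub>?R\<^esub> U = S \<otimes>\<^bsub>?R\<^esub> (T \<otimes>\<^bsub>?R\<^esub> U)"
      by simp (intro gs_eqI[of _ m] gs_closed, simp add: gs_eval_mult gs_mat_assoc)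
  next
    fix S assume S: "S \<in> carrier ?R"
    show "\<one>\<^bsub>?R\<^esub> \<otimes>\<^bsub>?R\<^esub> S = S" "S \<otimes>\<^bsub>?R\<^esub> \<one>\<^bsub>?R\<^esub> = S"
      using S left_mult_one_mat[OF gs_eval_carrier] right_mult_one_mat[OF gs_eval_carrier]
      by (auto intro!: gs_eqI[of _ m] simp: gs_closed gs_eval_mult gs_eval_one)
  qed (auto simp: gs_closed)
  have ring: "ring ?R"
  proof (rule ringI[OF group monoid])
    fix S T U assume STU: "S \<in> carrier ?R" "T \<in> carrier ?R" "U \<in> carrier ?R"
    show "(S \<oplus>\<^bsub>?R\<^esub> T) \<otimes>\<^bsub>?R\<^esub> U = S \<otimes>\<^bsub>?R\<^esub> U \<oplus>\<^bsub>?R\<^esub> T \<otimes>\<^bsub>?R\<^esub> U"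
      using add_mult_distrib_mat[OF gs_eval_carrier gs_eval_carrier gs_eval_carrier]
      by (auto intro!: gs_eqI[of _ m] simp: gs_closed gs_eval_mult gs_eval_add)
    show "U \<otimes>\<^bsub>?R\<^esub> (S \<oplus>\<^bsub>?R\<^esub> T) = U \<otimes>\<^bsub>?R\<^esub> S \<oplus>\<^bsub>?R\<^esub> U \<otimes>\<^bsub>?R\<^esub> T"
      using mult_add_distrib_mat[OF gs_eval_carrier gs_eval_carrier gs_eval_carrier]
      by (auto intro!: gs_eqI[of _ m] simp: gs_closed gs_eval_mult gs_eval_add)
  qed
  then show ?thesis
    by (intro nc_algebra.intro nc_algebra_axioms.intro) (simp_all add: gs_closed)
qed

lemma nc_hom_gs_eval: "nc_hom (gs_alg m) (mat_alg_via fps_const (m * s)) (gs_eval m s Z)"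
  by (simp add: nc_hom_def gs_eval_hom_simps)

section \<open>Expressions on a line\<close>

text \<open>The Kronecker product of \<open>M\<close> with the identity matrix of size \<open>s\<close>. It is the value at size \<open>m s\<close> of the
constant series \<open>M\<close>.\<close>

definition inflate :: "nat \<Rightarrow> nat \<Rightarrow> 'a::zero mat \<Rightarrow> 'a mat" where
  "inflate m s M = mat (m * s) (m * s)
     (\<lambda>(i, j). if i mod s = j mod s then M $$ (i div s, j div s) else 0)"

text \<open>The polynomial \<open>P \<otimes> 1 + t Z\<close> with matrix values: a line through the inflated base point.\<close>

definition line_mat ::
  "nat \<Rightarrow> nat \<Rightarrow> ('x \<Rightarrow> 'k::field mat) \<Rightarrow> ('x \<Rightarrow> 'k mat) \<Rightarrow> 'x \<Rightarrow> 'k poly mat" where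
  "line_mat m s P Z x = mat (m * s) (m * s) (\<lambda>ij. [:inflate m s (P x) $$ ij, Z x $$ ij:])"

abbreviation line_at ::
  "nat \<Rightarrow> nat \<Rightarrow> ('x \<Rightarrow> 'k::field mat) \<Rightarrow> ('x \<Rightarrow> 'k mat) \<Rightarrow> 'k \<Rightarrow> 'x \<Rightarrow> 'k mat" where
  "line_at m s P Z \<tau> x \<equiv> map_mat (\<lambda>p. poly p \<tau>) (line_mat m s P Z x)"

lemma line_mat_carrier [simp]: "line_mat m s P Z x \<in> carrier_mat (m * s) (m * s)"
  by (simp add: line_mat_def)

lemma line_at_tuple: "line_at m s P Z \<tau> \<in> mat_tuples (m * s)"
  by (simp add: mat_tuples_def)

lemma gs_shift_closed: "gs_shift m P x \<in> carrier (gs_alg m)"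
  by (simp add: gs_shift_def gs_closed)

lemma gs_eval_shift:
  "gs_eval m s Z (gs_shift m P x) = map_mat fps_of_poly (line_mat m s P Z x)"
  by (rule eq_matI)
     (auto simp: gs_shift_def gs_eval_add gs_eval_letter gs_eval_const line_mat_def inflate_def
       fps_of_poly_pCons)

lemma comm_ring_hom_fps_of_poly: "comm_ring_hom (fps_of_poly :: 'k::comm_ring_1 poly \<Rightarrow> 'k fps)"
  by unfold_locales (simp_all add: fps_of_poly_add fps_of_poly_mult)

lemma comm_ring_hom_poly: "comm_ring_hom (\<lambda>p. poly p (\<tau>::'k::comm_ring_1))"
  by unfold_locales simp_all

lemma smult_smult_mat: "c \<cdot>\<^sub>m (d \<cdot>\<^sub>m X) = (c * d) \<cdot>\<^sub>m (X :: 'a::comm_ring_1 mat)"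
  and one_smult_mat: "1 \<cdot>\<^sub>m (X :: 'a mat) = X"
  by (auto intro!: eq_matI simp: mult.assoc)

text \<open>The next three lemmas are the arithmetic of fractions: they clear denominators in a sum, a product
and an inverse. The inverse uses a matrix \<open>J\<close> with \<open>J M = \<delta>\<close>, which will be the adjugate of \<open>M\<close>.\<close>

lemma smult_add_clear:
  fixes X1 :: "'a::comm_ring_1 mat"
  assumes "X1 \<in> carrier_mat n n" "X2 \<in> carrier_mat n n" "d1 \<cdot>\<^sub>m X1 = M1" "d2 \<cdot>\<^sub>m X2 = M2"
  shows "(d1 * d2) \<cdot>\<^sub>m (X1 + X2) = d2 \<cdot>\<^sub>m M1 + d1 \<cdot>\<^sub>m M2"
  unfolding assms(3,4)[symmetric]
  by (rule eq_matI) (use assms(1,2) in \<open>auto simp: algebra_simps\<close>)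

lemma smult_mult_clear:
  fixes X1 :: "'a::comm_ring_1 mat"
  assumes X: "X1 \<in> carrier_mat n n" "X2 \<in> carrier_mat n n" and "d1 \<cdot>\<^sub>m X1 = M1" "d2 \<cdot>\<^sub>m X2 = M2"
  shows "(d1 * d2) \<cdot>\<^sub>m (X1 * X2) = M1 * M2"
proof -
  have "M1 * M2 = d1 \<cdot>\<^sub>m (X1 * (d2 \<cdot>\<^sub>m X2))"
    unfolding assms(3,4)[symmetric] using X by (intro mult_smult_assoc_mat) auto
  also have "X1 * (d2 \<cdot>\<^sub>m X2) = d2 \<cdot>\<^sub>m (X1 * X2)"
    using X by (intro mult_smult_distrib) auto
  finally show ?thesis
    by (simp add: smult_smult_mat)
qed

lemma smult_inverse_clear:
  fixes X :: "'a::comm_ring_1 mat"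
  assumes X: "X \<in> carrier_mat n n" and Y: "Y \<in> carrier_mat n n" and J: "J \<in> carrier_mat n n"
    and XY: "X * Y = 1\<^sub>m n" and M: "d \<cdot>\<^sub>m X = M" and JM: "J * M = \<delta> \<cdot>\<^sub>m 1\<^sub>m n"
  shows "(d * \<delta>) \<cdot>\<^sub>m Y = (d * d) \<cdot>\<^sub>m J"
proof -
  have "\<delta> \<cdot>\<^sub>m Y = (J * M) * Y"
    unfolding JM using Y by (simp add: mult_smult_assoc_mat[of _ n n _ n])
  also have "\<dots> = J * (M * Y)"
    using J X Y M by (intro assoc_mult_mat) auto
  also have "M * Y = d \<cdot>\<^sub>m 1\<^sub>m n"
    unfolding M[symmetric] XY[symmetric] using X Y by (intro mult_smult_assoc_mat) auto
  also have "J * (d \<cdot>\<^sub>m 1\<^sub>m n) = d \<cdot>\<^sub>m J"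
    using mult_smult_distrib[OF J, of "1\<^sub>m n" n d] J by simp
  finally have "d \<cdot>\<^sub>m (\<delta> \<cdot>\<^sub>m Y) = d \<cdot>\<^sub>m (d \<cdot>\<^sub>m J)" by simp
  then show ?thesis by (simp add: smult_smult_mat)
qed

text \<open>On the line the expression is the fraction \<open>M / d\<close>, both as a power series at the base point and as a
function of the parameter. It matters that \<open>d\<close> vanishes only where the expression is undefined: the
conclusion for an arbitrary point of the domain is drawn by putting that point at the parameter \<open>1\<close>.\<close>

definition fraction_on_line ::
  "nat \<Rightarrow> nat \<Rightarrow> ('x::finite \<Rightarrow> 'k::field mat) \<Rightarrow> ('x \<Rightarrow> 'k mat) \<Rightarrow> ('x, 'k) nc_expr \<Rightarrow>
   'k poly mat \<Rightarrow> 'k poly \<Rightarrow> bool" where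
  "fraction_on_line m s P Z r M d \<longleftrightarrow>
     M \<in> carrier_mat (m * s) (m * s) \<and> poly d 0 \<noteq> 0 \<and>
     fps_of_poly d \<cdot>\<^sub>m gs_eval m s Z (nc_eval (gs_alg m) (gs_shift m P) r) =
       map_mat fps_of_poly M \<and>
     (\<forall>\<tau>. nc_defined (mat_alg (m * s)) (line_at m s P Z \<tau>) r \<longleftrightarrow> poly d \<tau> \<noteq> 0) \<and>
     (\<forall>\<tau>. poly d \<tau> \<noteq> 0 \<longrightarrow>
       poly d \<tau> \<cdot>\<^sub>m nc_eval (mat_alg (m * s)) (line_at m s P Z \<tau>) r =
         map_mat (\<lambda>p. poly p \<tau>) M)"

lemma nc_algebra_mat_alg: "nc_algebra (mat_alg N :: ('k::field, 'k mat) module)"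
  unfolding mat_alg_eq_via by (rule nc_algebra_mat_alg_via)

lemma nc_eval_mat_carrier:
  assumes "A \<in> mat_tuples N" "nc_defined (mat_alg N) A r"
  shows "nc_eval (mat_alg N) A r \<in> carrier_mat N N"
proof -
  have "nc_eval (mat_alg N) A r \<in> carrier (mat_alg N)"
    by (rule nc_algebra.nc_eval_closed[OF nc_algebra_mat_alg _ assms(2)])
       (use assms(1) in \<open>auto simp: mat_tuples_def module_mat_simps\<close>)
  then show ?thesis by (simp add: module_mat_simps)
qed

lemma fraction_on_line_poly: "\<exists>M d. fraction_on_line m s P Z (NC_Poly p) M d"
proof (intro exI)
  let ?N = "m * s"
  let ?A = "mat_alg_via (\<lambda>c. [:c:]) ?N"
  let ?L = "line_mat m s P Z"
  let ?M = "nc_poly_eval ?A ?L p"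
  have L: "?L x \<in> carrier ?A" for x by simp
  have "map_mat fps_of_poly ?M =
      nc_poly_eval (mat_alg_via fps_const ?N) (\<lambda>x. map_mat fps_of_poly (?L x)) p"
    by (rule nc_poly_eval_hom[OF nc_algebra_mat_alg_via nc_algebra_mat_alg_via
          nc_hom_map_mat[OF comm_ring_hom_fps_of_poly fps_of_poly_const] L])
  moreover have "gs_eval m s Z (nc_poly_eval (gs_alg m) (gs_shift m P) p) =
      nc_poly_eval (mat_alg_via fps_const ?N) (\<lambda>x. gs_eval m s Z (gs_shift m P x)) p"
    by (rule nc_poly_eval_hom[OF nc_algebra_gs_alg nc_algebra_mat_alg_via nc_hom_gs_eval
          gs_shift_closed])
  moreover have "map_mat (\<lambda>p. poly p \<tau>) ?M =
      nc_poly_eval (mat_alg_via (\<lambda>c. c) ?N) (line_at m s P Z \<tau>) p" for \<tau>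
    by (rule nc_poly_eval_hom[OF nc_algebra_mat_alg_via nc_algebra_mat_alg_via
          nc_hom_map_mat[OF comm_ring_hom_poly] L]) simp
  moreover have "?M \<in> carrier ?A"
    by (rule nc_algebra.nc_poly_eval_closed[OF nc_algebra_mat_alg_via L])
  ultimately show "fraction_on_line m s P Z (NC_Poly p) ?M 1"
    unfolding fraction_on_line_def mat_alg_eq_via by (simp add: gs_eval_shift one_smult_mat)
qed

lemma fraction_on_line_add:
  assumes 1: "fraction_on_line m s P Z r1 M1 d1" and 2: "fraction_on_line m s P Z r2 M2 d2"
  shows "fraction_on_line m s P Z (NC_Add r1 r2) (d2 \<cdot>\<^sub>m M1 + d1 \<cdot>\<^sub>m M2) (d1 * d2)"
proof -
  have map: "map_mat \<psi> (d2 \<cdot>\<^sub>m M1 + d1 \<cdot>\<^sub>m M2) =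
      \<psi> d2 \<cdot>\<^sub>m map_mat \<psi> M1 + \<psi> d1 \<cdot>\<^sub>m map_mat \<psi> M2"
    if "comm_ring_hom \<psi>" for \<psi> :: "'b poly \<Rightarrow> 'c::comm_ring_1"
  proof -
    interpret comm_ring_hom \<psi> by fact
    show ?thesis
      using 1 2 by (intro eq_matI) (auto simp: fraction_on_line_def hom_distribs)
  qed
  have "(fps_of_poly d1 * fps_of_poly d2) \<cdot>\<^sub>m
      (gs_eval m s Z (nc_eval (gs_alg m) (gs_shift m P) r1) +
       gs_eval m s Z (nc_eval (gs_alg m) (gs_shift m P) r2)) =
      map_mat fps_of_poly (d2 \<cdot>\<^sub>m M1 + d1 \<cdot>\<^sub>m M2)"
    unfolding map[OF comm_ring_hom_fps_of_poly]
    by (rule smult_add_clear[OF gs_eval_carrier gs_eval_carrier])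
       (use 1 2 in \<open>auto simp: fraction_on_line_def\<close>)
  moreover have "(poly d1 \<tau> * poly d2 \<tau>) \<cdot>\<^sub>m
      (nc_eval (mat_alg (m * s)) (line_at m s P Z \<tau>) r1 +
       nc_eval (mat_alg (m * s)) (line_at m s P Z \<tau>) r2) =
      map_mat (\<lambda>p. poly p \<tau>) (d2 \<cdot>\<^sub>m M1 + d1 \<cdot>\<^sub>m M2)"
    if "poly d1 \<tau> \<noteq> 0" "poly d2 \<tau> \<noteq> 0" for \<tau>
    unfolding map[OF comm_ring_hom_poly]
    by (rule smult_add_clear[OF nc_eval_mat_carrier[OF line_at_tuple]
          nc_eval_mat_carrier[OF line_at_tuple]])
       (use 1 2 that in \<open>auto simp: fraction_on_line_def\<close>)
  ultimately show ?thesis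
    using 1 2
    by (auto simp: fraction_on_line_def fps_of_poly_mult gs_eval_add module_mat_simps)
qed

lemma fraction_on_line_mult:
  assumes 1: "fraction_on_line m s P Z r1 M1 d1" and 2: "fraction_on_line m s P Z r2 M2 d2"
  shows "fraction_on_line m s P Z (NC_Mult r1 r2) (M1 * M2) (d1 * d2)"
proof -
  have map: "map_mat \<psi> (M1 * M2) = map_mat \<psi> M1 * map_mat \<psi> M2"
    if "comm_ring_hom \<psi>" for \<psi> :: "'b poly \<Rightarrow> 'c::comm_ring_1"
  proof -
    interpret comm_ring_hom \<psi> by fact
    show ?thesis
      using 1 2 by (intro mat_hom_mult) (auto simp: fraction_on_line_def)
  qed
  have "(fps_of_poly d1 * fps_of_poly d2) \<cdot>\<^sub>m
      (gs_eval m s Z (nc_eval (gs_alg m) (gs_shift m P) r1) *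
       gs_eval m s Z (nc_eval (gs_alg m) (gs_shift m P) r2)) =
      map_mat fps_of_poly (M1 * M2)"
    unfolding map[OF comm_ring_hom_fps_of_poly]
    by (rule smult_mult_clear[OF gs_eval_carrier gs_eval_carrier])
       (use 1 2 in \<open>auto simp: fraction_on_line_def\<close>)
  moreover have "(poly d1 \<tau> * poly d2 \<tau>) \<cdot>\<^sub>m
      (nc_eval (mat_alg (m * s)) (line_at m s P Z \<tau>) r1 *
       nc_eval (mat_alg (m * s)) (line_at m s P Z \<tau>) r2) =
      map_mat (\<lambda>p. poly p \<tau>) (M1 * M2)"
    if "poly d1 \<tau> \<noteq> 0" "poly d2 \<tau> \<noteq> 0" for \<tau>
    unfolding map[OF comm_ring_hom_poly]
    by (rule smult_mult_clear[OF nc_eval_mat_carrier[OF line_at_tuple]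
          nc_eval_mat_carrier[OF line_at_tuple]])
       (use 1 2 that in \<open>auto simp: fraction_on_line_def\<close>)
  ultimately show ?thesis
    using 1 2
    by (auto simp: fraction_on_line_def fps_of_poly_mult gs_eval_mult module_mat_simps)
qed

text \<open>By Cramer's rule \<open>(M / d)\<^sup>-\<^sup>1 = d\<^sup>2 adj M / (d det M)\<close>. At a parameter where \<open>d\<close> is nonzero, \<open>M / d\<close> is
invertible exactly if \<open>det M\<close> is nonzero there. At the parameter \<open>0\<close> this holds because the
series is invertible.\<close>

lemma fraction_on_line_inv:
  fixes Z :: "'x::finite \<Rightarrow> 'k::field mat"
  assumes 1: "fraction_on_line m s P Z r M d"
    and def: "nc_defined (gs_alg m) (gs_shift m P) (NC_Inv r)"
  shows "fraction_on_line m s P Z (NC_Inv r) ((d * d) \<cdot>\<^sub>m adj_mat M) (d * det M)"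
proof -
  let ?N = "m * s"
  let ?S = "nc_eval (gs_alg m) (gs_shift m P) r"
  let ?F = "gs_eval m s Z ?S"
  let ?X = "\<lambda>\<tau>. nc_eval (mat_alg ?N) (line_at m s P Z \<tau>) r"
  interpret R: nc_algebra "gs_alg m :: ('k, ('x, 'k) gseries) module"
    by (rule nc_algebra_gs_alg)
  interpret K: nc_algebra "mat_alg ?N :: ('k, 'k mat) module"
    by (rule nc_algebra_mat_alg)
  have M: "M \<in> carrier_mat ?N ?N" and d0: "poly d 0 \<noteq> 0"
    and F: "fps_of_poly d \<cdot>\<^sub>m ?F = map_mat fps_of_poly M"
    and dom: "\<And>\<tau>. nc_defined (mat_alg ?N) (line_at m s P Z \<tau>) r \<longleftrightarrow> poly d \<tau> \<noteq> 0"
    and X: "\<And>\<tau>. poly d \<tau> \<noteq> 0 \<Longrightarrow> poly d \<tau> \<cdot>\<^sub>m ?X \<tau> = map_mat (\<lambda>p. poly p \<tau>) M"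
    using 1 by (auto simp: fraction_on_line_def)
  note J = adj_mat[OF M]
  have map: "map_mat \<psi> (adj_mat M) * map_mat \<psi> M = \<psi> (det M) \<cdot>\<^sub>m 1\<^sub>m ?N"
    "map_mat \<psi> ((d * d) \<cdot>\<^sub>m adj_mat M) = (\<psi> d * \<psi> d) \<cdot>\<^sub>m map_mat \<psi> (adj_mat M)"
    if "comm_ring_hom \<psi>" for \<psi> :: "'k poly \<Rightarrow> 'c::comm_ring_1"
  proof -
    interpret comm_ring_hom \<psi> by fact
    have "map_mat \<psi> (adj_mat M) * map_mat \<psi> M = map_mat \<psi> (adj_mat M * M)"
      by (rule mat_hom_mult[OF J(1) M, symmetric])
    also have "\<dots> = \<psi> (det M) \<cdot>\<^sub>m 1\<^sub>m ?N"
      unfolding J(3) by (rule eq_matI) auto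
    finally show "map_mat \<psi> (adj_mat M) * map_mat \<psi> M = \<psi> (det M) \<cdot>\<^sub>m 1\<^sub>m ?N" .
    show "map_mat \<psi> ((d * d) \<cdot>\<^sub>m adj_mat M) = (\<psi> d * \<psi> d) \<cdot>\<^sub>m map_mat \<psi> (adj_mat M)"
      by (rule eq_matI) (auto simp: hom_distribs)
  qed
  define S' where "S' = inv\<^bsub>gs_alg m\<^esub> ?S"
  have "?S \<in> Units (gs_alg m)" using def by simp
  then have "?S \<otimes>\<^bsub>gs_alg m\<^esub> S' = \<one>\<^bsub>gs_alg m\<^esub>"
    unfolding S'_def by (rule R.Units_r_inv)
  then have FF': "?F * gs_eval m s Z S' = 1\<^sub>m ?N"
    using gs_eval_mult[of m s Z ?S S'] gs_eval_one[of m s Z] by simp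
  have series: "fps_of_poly (d * det M) \<cdot>\<^sub>m gs_eval m s Z S' =
      map_mat fps_of_poly ((d * d) \<cdot>\<^sub>m adj_mat M)"
    unfolding map(2)[OF comm_ring_hom_fps_of_poly] fps_of_poly_mult
    by (rule smult_inverse_clear[OF gs_eval_carrier gs_eval_carrier _ FF' F
          map(1)[OF comm_ring_hom_fps_of_poly]]) (use J(1) in simp)
  have det_poly: "det (map_mat (\<lambda>p. poly p \<tau>) M) = poly (det M) \<tau>" for \<tau>
    by (rule comm_ring_hom.hom_det[OF comm_ring_hom_poly])
  \<comment> \<open>The constant term of a unit of \<open>k[[t]]\<close> is nonzero.\<close>
  have "poly (det M) 0 \<noteq> 0"
  proof -
    have "det ?F * det (gs_eval m s Z S') = 1"
      using det_mult[of ?F ?N "gs_eval m s Z S'"] FF' by simp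
    then have "fps_nth (det ?F) 0 * fps_nth (det (gs_eval m s Z S')) 0 = 1"
      by (metis fps_mult_nth_0 fps_one_nth)
    then have "fps_nth (det ?F) 0 \<noteq> 0" by auto
    moreover have "fps_of_poly (det M) = fps_of_poly d ^ ?N * det ?F"
      using arg_cong[OF F, of det] comm_ring_hom.hom_det[OF comm_ring_hom_fps_of_poly, of M]
      by simp
    then have "poly (det M) 0 = poly d 0 ^ ?N * fps_nth (det ?F) 0"
      by (metis fps_mult_nth_0 fps_nth_power_0 fps_of_poly_nth poly_0_coeff_0)
    ultimately show ?thesis using d0 by simp
  qed
  then have d0': "poly (d * det M) 0 \<noteq> 0" using d0 by simp
  have Xc: "?X \<tau> \<in> carrier_mat ?N ?N" if "poly d \<tau> \<noteq> 0" for \<tau>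
    using nc_eval_mat_carrier[OF line_at_tuple] dom that by blast
  have unit: "?X \<tau> \<in> Units (mat_alg ?N) \<longleftrightarrow> poly (det M) \<tau> \<noteq> 0" if "poly d \<tau> \<noteq> 0" for \<tau>
  proof -
    have "poly (det M) \<tau> = poly d \<tau> ^ ?N * det (?X \<tau>)"
      using arg_cong[OF X[OF that], of det] Xc[OF that] by (simp add: det_poly)
    then show ?thesis
      using that Units_mat_alg_iff[OF Xc[OF that]] by simp
  qed
  have dom': "nc_defined (mat_alg ?N) (line_at m s P Z \<tau>) (NC_Inv r) \<longleftrightarrow> poly (d * det M) \<tau> \<noteq> 0"
    for \<tau>
    using dom[of \<tau>] unit[of \<tau>] by auto
  have val: "poly (d * det M) \<tau> \<cdot>\<^sub>m nc_eval (mat_alg ?N) (line_at m s P Z \<tau>) (NC_Inv r) =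
      map_mat (\<lambda>p. poly p \<tau>) ((d * d) \<cdot>\<^sub>m adj_mat M)" if "poly (d * det M) \<tau> \<noteq> 0" for \<tau>
  proof -
    have d: "poly d \<tau> \<noteq> 0" using that by auto
    have u: "?X \<tau> \<in> Units (mat_alg ?N)" using unit[OF d] that by simp
    have "?X \<tau> * inv\<^bsub>mat_alg ?N\<^esub> (?X \<tau>) = 1\<^sub>m ?N"
      using K.Units_r_inv[OF u] by (simp add: module_mat_simps)
    moreover have "inv\<^bsub>mat_alg ?N\<^esub> (?X \<tau>) \<in> carrier_mat ?N ?N"
      using K.Units_inv_closed[OF u] by (simp add: module_mat_simps)
    ultimately have "(poly d \<tau> * poly (det M) \<tau>) \<cdot>\<^sub>m inv\<^bsub>mat_alg ?N\<^esub> (?X \<tau>) =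
        (poly d \<tau> * poly d \<tau>) \<cdot>\<^sub>m map_mat (\<lambda>p. poly p \<tau>) (adj_mat M)"
      by (intro smult_inverse_clear[OF Xc[OF d] _ _ _ X[OF d] map(1)[OF comm_ring_hom_poly]])
         (use J(1) in auto)
    then show ?thesis
      unfolding map(2)[OF comm_ring_hom_poly] by simp
  qed
  show ?thesis
    unfolding fraction_on_line_def using series d0' dom' val J(1) by (simp add: S'_def)
qed

lemma fraction_on_line_exists:
  assumes "nc_defined (gs_alg m) (gs_shift m P) r"
  shows "\<exists>M d. fraction_on_line m s P Z r M d"
  using assms
proof (induction r)
  case (NC_Poly p)
  show ?case by (rule fraction_on_line_poly)
next
  case (NC_Add r1 r2)
  then show ?case using fraction_on_line_add by (metis nc_defined.simps(2))
next
  case (NC_Mult r1 r2)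
  then show ?case using fraction_on_line_mult by (metis nc_defined.simps(3))
next
  case (NC_Inv r)
  then show ?case using fraction_on_line_inv by (metis nc_defined.simps(4))
qed

text \<open>The hypothesis kills the numerator at every parameter where the nonzero polynomial \<open>d\<close> does not vanish.
Over an infinite field the numerator is therefore zero.\<close>

lemma fraction_on_line_vanish:
  fixes r :: "('x::finite, 'k::field_char_0) nc_expr"
  assumes frac: "fraction_on_line m s P Z r M d" and id: "identity_on_size r (m * s)"
    and pos: "m * s \<ge> 1"
  shows "gs_eval m s Z (nc_eval (gs_alg m) (gs_shift m P) r) = 0\<^sub>m (m * s) (m * s)"
proof (rule eq_matI)
  let ?N = "m * s"
  let ?F = "gs_eval m s Z (nc_eval (gs_alg m) (gs_shift m P) r)"
  fix i j assume "i < dim_row (0\<^sub>m ?N ?N :: 'k fps mat)" "j < dim_col (0\<^sub>m ?N ?N :: 'k fps mat)"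
  then have ij: "i < ?N" "j < ?N" by auto
  have M: "M \<in> carrier_mat ?N ?N" and d0: "d \<noteq> 0"
    using frac by (auto simp: fraction_on_line_def)
  have "poly (M $$ (i, j) * d) \<tau> = 0" for \<tau>
  proof (cases "poly d \<tau> = 0")
    case False
    then have "line_at m s P Z \<tau> \<in> nc_dom r \<inter> mat_tuples ?N"
      using frac pos line_at_tuple unfolding fraction_on_line_def nc_dom_def by blast
    then have "nc_eval (mat_alg ?N) (line_at m s P Z \<tau>) r = 0\<^sub>m ?N ?N"
      using id by (simp add: identity_on_size_def)
    then have "map_mat (\<lambda>p. poly p \<tau>) M = poly d \<tau> \<cdot>\<^sub>m 0\<^sub>m ?N ?N"
      using frac False unfolding fraction_on_line_def by metis
    from arg_cong[OF this, of "\<lambda>X. X $$ (i, j)"] show ?thesis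
      using M ij by simp
  qed simp
  then have "M $$ (i, j) * d = 0"
    by (simp add: poly_all_0_iff_0[symmetric] del: mult_eq_0_iff)
  then have Mij: "M $$ (i, j) = 0" using d0 by simp
  have "fps_of_poly d \<cdot>\<^sub>m ?F = map_mat fps_of_poly M"
    using frac by (simp add: fraction_on_line_def)
  from arg_cong[OF this, of "\<lambda>X. X $$ (i, j)"]
  have "fps_of_poly d * ?F $$ (i, j) = 0"
    using M ij Mij by simp
  then show "?F $$ (i, j) = (0\<^sub>m ?N ?N) $$ (i, j)"
    using d0 ij by simp
qed simp_all

section \<open>Coefficients of a series with a realization\<close>

definition supported_on :: "('x, 'k::zero) gseries \<Rightarrow> 'x list \<Rightarrow> bool" where
  "supported_on S u \<longleftrightarrow> (\<forall>w es. w \<noteq> u \<longrightarrow> S w es = 0)"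

lemma gs_coord_supported: "supported_on S u \<Longrightarrow> map fst v \<noteq> u \<Longrightarrow> gs_coord S p q v = 0"
  by (simp add: supported_on_def gs_coord_def)

lemma supported_on_mult:
  fixes S T :: "('x, 'k::field) gseries"
  assumes "supported_on S u" "supported_on T v"
  shows "supported_on (gs_mult m S T) (u @ v)"
proof -
  have zero: "S (take j w) es * T (drop j w) es' = 0" if "w \<noteq> u @ v" for w j es es'
  proof -
    have "take j w \<noteq> u \<or> drop j w \<noteq> v" using that by (metis append_take_drop_id)
    then show ?thesis using assms by (auto simp: supported_on_def)
  qed
  show ?thesis
    unfolding supported_on_def
  proof (intro allI impI)
    fix w es assume "w \<noteq> u @ v"
    then show "gs_mult m S T w es = 0"
      using zero[OF \<open>w \<noteq> u @ v\<close>] by (auto simp: gs_mult_def intro!: sum.neutral)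
  qed
qed

lemma gs_bimodule_supported:
  fixes S :: "('x, 'k::field) gseries"
  assumes "S \<in> gs_bimodule m x"
  shows "S \<in> gs_carrier m \<and> supported_on S [x]"
  using assms
proof induction
  case zero
  then show ?case using gs_closed(1) by (simp add: supported_on_def) (simp add: gs_zero_def)
next
  case (add S a b)
  have "supported_on (gs_const m a :: ('x, 'k) gseries) []"
    "supported_on (gs_const m b :: ('x, 'k) gseries) []"
    "supported_on (gs_letter m x :: ('x, 'k) gseries) [x]"
    by (simp_all add: supported_on_def gs_const_def gs_letter_def)
  then have "supported_on (gs_mult m (gs_mult m (gs_const m a) (gs_letter m x)) (gs_const m b))
      (([] @ [x]) @ [])"
    by (intro supported_on_mult)
  with add show ?case
    by (simp add: gs_closed) (simp add: supported_on_def gs_add_def)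
qed

lemma gs_finsum_coord:
  fixes f :: "'i \<Rightarrow> ('x::finite, 'k::field) gseries"
  assumes "finite K" "\<And>i. i \<in> K \<Longrightarrow> f i \<in> gs_carrier m"
  shows "finsum (gs_alg m) f K \<in> gs_carrier m \<and>
    gs_coord (finsum (gs_alg m) f K) p q v = (\<Sum>i\<in>K. gs_coord (f i) p q v)"
  using assms
proof induction
  interpret R: nc_algebra "gs_alg m :: ('k, ('x, 'k) gseries) module"
    by (rule nc_algebra_gs_alg)
  case empty
  then show ?case using R.finsum_empty[of f] by (simp add: gs_closed)
next
  interpret R: nc_algebra "gs_alg m :: ('k, ('x, 'k) gseries) module"
    by (rule nc_algebra_gs_alg)
  case (insert i K)
  have "finsum (gs_alg m) f (insert i K) = f i \<oplus>\<^bsub>gs_alg m\<^esub> finsum (gs_alg m) f K"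
    by (rule R.finsum_insert) (use insert in auto)
  then show ?case
    using insert by (simp add: gs_coord_add gs_closed)
qed

lemma gs_coord_const_mult:
  assumes "p < m" "q < m" "set v \<subseteq> gs_letters m"
  shows "gs_coord (gs_mult m (gs_const m a) S) p q v = (\<Sum>t<m. a $$ (p, t) * gs_coord S t q v)"
proof -
  have "(\<Sum>t<m. gs_coord (gs_const m a) p t (take j v) * gs_coord S t q (drop j v)) =
      (if j = 0 then \<Sum>t<m. a $$ (p, t) * gs_coord S t q v else 0)" if "j \<in> {..length v}" for j
    using assms that by (auto simp: gs_coord_const intro!: sum.cong sum.neutral)
  then have "gs_coord (gs_mult m (gs_const m a) S) p q v =
      (\<Sum>j\<le>length v. if j = 0 then \<Sum>t<m. a $$ (p, t) * gs_coord S t q v else 0)"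
    unfolding gs_coord_mult[OF assms] by (rule sum.cong[OF refl])
  then show ?thesis by simp
qed

lemma gs_coord_mult_const:
  assumes "p < m" "q < m" "set v \<subseteq> gs_letters m"
  shows "gs_coord (gs_mult m S (gs_const m a)) p q v = (\<Sum>t<m. gs_coord S p t v * a $$ (t, q))"
proof -
  have "(\<Sum>t<m. gs_coord S p t (take j v) * gs_coord (gs_const m a) t q (drop j v)) =
      (if j = length v then \<Sum>t<m. gs_coord S p t v * a $$ (t, q) else 0)" if "j \<in> {..length v}" for j
    using assms that by (auto simp: gs_coord_const intro!: sum.cong sum.neutral)
  then have "gs_coord (gs_mult m S (gs_const m a)) p q v =
      (\<Sum>j\<le>length v. if j = length v then \<Sum>t<m. gs_coord S p t v * a $$ (t, q) else 0)"
    unfolding gs_coord_mult[OF assms] by (rule sum.cong[OF refl])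
  then show ?thesis by simp
qed

lemma gs_coord_letter_mult:
  assumes "p < m" "q < m" "set (y # v) \<subseteq> gs_letters m" and S: "supported_on S [fst y]"
  shows "gs_coord (gs_mult m S T) p q (y # v) = (\<Sum>t<m. gs_coord S p t [y] * gs_coord T t q v)"
proof -
  have "(\<Sum>t<m. gs_coord S p t (take j (y # v)) * gs_coord T t q (drop j (y # v))) =
      (if j = 1 then \<Sum>t<m. gs_coord S p t [y] * gs_coord T t q v else 0)"
    if "j \<in> {..length (y # v)}" for j
  proof (cases "j = 1")
    case False
    then have "length (take j (y # v)) \<noteq> 1" using that by auto
    then have "map fst (take j (y # v)) \<noteq> [fst y]"
      by (metis length_map length_Cons list.size(3) One_nat_def)
    then show ?thesis
      using False gs_coord_supported[OF S] by simp
  qed simp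
  then have "gs_coord (gs_mult m S T) p q (y # v) =
      (\<Sum>j\<le>length (y # v). if j = 1 then \<Sum>t<m. gs_coord S p t [y] * gs_coord T t q v else 0)"
    unfolding gs_coord_mult[OF assms(1-3)] by (rule sum.cong[OF refl])
  then show ?thesis by (simp del: sum.atMost_Suc)
qed

text \<open>In the coordinates, a linear representation of dimension \<open>n\<close> over \<open>M\<^sub>m(k)\<close> is one of dimension \<open>n m\<close> over
\<open>k\<close> in the letters \<open>(x, q, p)\<close>; \<open>rep_matrix\<close> gives its matrices. An index below \<open>n * m\<close> has the row of the
block as its quotient by \<open>m\<close>.\<close>

definition rep_matrix ::
  "nat \<Rightarrow> ('x \<Rightarrow> nat \<Rightarrow> nat \<Rightarrow> ('x, 'k) gseries) \<Rightarrow> 'x \<times> nat \<times> nat \<Rightarrow> nat \<Rightarrow> nat \<Rightarrow> 'k" where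
  "rep_matrix m A y I J =
     gs_coord (A (fst y) (I div m) (J div m)) (I mod m) (J mod m) [y]"

lemma rep_word_coord:
  fixes A :: "'x::finite \<Rightarrow> nat \<Rightarrow> nat \<Rightarrow> ('x, 'k::field) gseries"
  assumes A: "\<And>x i j. i < n \<Longrightarrow> j < n \<Longrightarrow> A x i j \<in> gs_bimodule m x"
    and "i < n" "j < n" "p < m" "q < m" "set v \<subseteq> gs_letters m"
  shows "gs_coord (rep_word m n A (map fst v) i j) p q v =
    word_prod (n * m) (rep_matrix m A) v (i * m + p) (j * m + q)"
  using assms(2-)
proof (induction v arbitrary: i p)
  case Nil
  have "i * m + p = j * m + q \<longleftrightarrow> i = j \<and> p = q"
    using Nil.prems by (metis div_mult_self3 div_less add_0_right mod_mult_self3 mod_less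
        less_nat_zero_code)
  then show ?case
    using Nil.prems by (auto simp: gs_coord_const)
next
  case (Cons y v)
  note supp = gs_bimodule_supported[OF A]
  let ?x = "fst y"
  let ?U = "\<lambda>l. rep_word m n A (map fst v) l j"
  have v: "set v \<subseteq> gs_letters m" using Cons.prems by simp
  have "gs_coord (rep_word m n A (map fst (y # v)) i j) p q (y # v) =
      (\<Sum>l<n. gs_coord (gs_mult m (A ?x i l) (?U l)) p q (y # v))"
    using gs_finsum_coord[of "{..<n}" "\<lambda>l. gs_mult m (A ?x i l) (?U l)" m p q "y # v"]
    by (simp add: gs_closed)
  also have "\<dots> = (\<Sum>l<n. \<Sum>t<m. gs_coord (A ?x i l) p t [y] * gs_coord (?U l) t q v)"
    using Cons.prems supp by (intro sum.cong refl gs_coord_letter_mult) auto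
  also have "\<dots> = (\<Sum>l<n. \<Sum>t<m. rep_matrix m A y (i * m + p) (l * m + t) *
      word_prod (n * m) (rep_matrix m A) v (l * m + t) (j * m + q))"
    using Cons.prems Cons.IH v by (intro sum.cong refl) (simp add: rep_matrix_def[of m A y])
  finally show ?case
    by (simp add: sum_lessThan_mult)
qed

lemma represents_coord:
  fixes A :: "'x::finite \<Rightarrow> nat \<Rightarrow> nat \<Rightarrow> ('x, 'k::field) gseries"
  assumes lin: "linear_representation m n c A b" and rep: "represents m n c A b S"
    and pq: "p < m" "q < m" and v: "set v \<subseteq> gs_letters m"
  shows "gs_coord S p q v = (\<Sum>I<n * m. \<Sum>J<n * m.
    c (I div m) $$ (p, I mod m) * word_prod (n * m) (rep_matrix m A) v I J *
    b (J div m) $$ (J mod m, q))"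
proof -
  have A: "A x i j \<in> gs_bimodule m x" if "i < n" "j < n" for x i j
    using lin that by (simp add: linear_representation_def)
  let ?T = "\<lambda>i j. gs_mult m (gs_mult m (gs_const m (c i)) (rep_word m n A (map fst v) i j))
    (gs_const m (b j))"
  let ?W = "word_prod (n * m) (rep_matrix m A) v"
  have "gs_coord S p q v = gs_coord (gs_component S (map fst v)) p q v"
    by (simp add: gs_coord_def gs_component_def)
  also have "gs_component S (map fst v) =
      finsum (gs_alg m) (\<lambda>i. finsum (gs_alg m) (\<lambda>j. ?T i j) {..<n}) {..<n}"
    using rep by (simp add: represents_def)
  also have "gs_coord \<dots> p q v = (\<Sum>i<n. \<Sum>j<n. gs_coord (?T i j) p q v)"
    by (simp add: gs_finsum_coord gs_closed)
  also have "\<dots> = (\<Sum>i<n. \<Sum>j<n. \<Sum>t'<m. \<Sum>t<m.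
      c i $$ (p, t) * ?W (i * m + t) (j * m + t') * b j $$ (t', q))"
    using pq v
    by (intro sum.cong refl)
       (simp add: gs_coord_mult_const gs_coord_const_mult rep_word_coord[OF A] sum_distrib_right)
  also have "\<dots> = (\<Sum>i<n. \<Sum>t<m. \<Sum>j<n. \<Sum>t'<m.
      c i $$ (p, t) * ?W (i * m + t) (j * m + t') * b j $$ (t', q))"
  proof (rule sum.cong[OF refl])
    fix i
    have "(\<Sum>j<n. \<Sum>t'<m. \<Sum>t<m. c i $$ (p, t) * ?W (i * m + t) (j * m + t') * b j $$ (t', q)) =
        (\<Sum>j<n. \<Sum>t<m. \<Sum>t'<m. c i $$ (p, t) * ?W (i * m + t) (j * m + t') * b j $$ (t', q))"
      by (rule sum.cong[OF refl], rule sum.swap)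
    also have "\<dots> = (\<Sum>t<m. \<Sum>j<n. \<Sum>t'<m.
        c i $$ (p, t) * ?W (i * m + t) (j * m + t') * b j $$ (t', q))"
      by (rule sum.swap)
    finally show "(\<Sum>j<n. \<Sum>t'<m. \<Sum>t<m.
          c i $$ (p, t) * ?W (i * m + t) (j * m + t') * b j $$ (t', q)) =
        (\<Sum>t<m. \<Sum>j<n. \<Sum>t'<m.
          c i $$ (p, t) * ?W (i * m + t) (j * m + t') * b j $$ (t', q))" .
  qed
  finally show ?thesis
    by (simp add: sum_lessThan_mult)
qed

text \<open>A shortest word with a nonzero coefficient at \<open>(p, q)\<close> is shortest for the scalar representation given by
row \<open>p\<close> of \<open>c\<close> and column \<open>q\<close> of \<open>b\<close>, whose dimension is \<open>n m\<close>.\<close>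

lemma represents_nonzero_short_word:
  fixes A :: "'x::finite \<Rightarrow> nat \<Rightarrow> nat \<Rightarrow> ('x, 'k::field) gseries"
  assumes lin: "linear_representation m n c A b" and rep: "represents m n c A b S"
    and pq: "p < m" "q < m" and v: "set v \<subseteq> gs_letters m" "gs_coord S p q v \<noteq> 0"
  obtains w where "set w \<subseteq> gs_letters m" "length w < n * m" "gs_coord S p q w \<noteq> 0"
proof -
  let ?P = "\<lambda>w. set w \<subseteq> gs_letters m \<and> gs_coord S p q w \<noteq> 0"
  obtain w where w: "?P w" and min: "\<And>u. ?P u \<Longrightarrow> length w \<le> length u"
    using ex_has_least_nat[of ?P v length] v by blast
  note coord = represents_coord[OF lin rep pq]
  have "length w < n * m"
  proof (rule shortest_nonzero_word_length)
    show "(\<Sum>I<n * m. \<Sum>J<n * m. c (I div m) $$ (p, I mod m) *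
        word_prod (n * m) (rep_matrix m A) w I J * b (J div m) $$ (J mod m, q)) \<noteq> 0"
      using w coord[of w] by simp
    fix u assume u: "set u \<subseteq> set w" "length u < length w"
    then have "set u \<subseteq> gs_letters m" using w by blast
    moreover have "gs_coord S p q u = 0"
      using min[of u] u \<open>set u \<subseteq> gs_letters m\<close> by force
    ultimately show "(\<Sum>I<n * m. \<Sum>J<n * m. c (I div m) $$ (p, I mod m) *
        word_prod (n * m) (rep_matrix m A) u I J * b (J div m) $$ (J mod m, q)) = 0"
      using coord[of u] by simp
  qed
  then show ?thesis using that w by blast
qed

section \<open>From the vanishing series to all sizes\<close>

text \<open>The Kronecker product of the identity matrix of size \<open>m\<close> with \<open>M\<close>: it moves a tuple of size \<open>s\<close> to the
size \<open>m s\<close>, where it can be joined by a line to the base point.\<close>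

definition mat_copies :: "nat \<Rightarrow> nat \<Rightarrow> 'a::zero mat \<Rightarrow> 'a mat" where
  "mat_copies m s M = mat (m * s) (m * s)
     (\<lambda>(i, j). if i div s = j div s then M $$ (i mod s, j mod s) else 0)"

lemma mat_copies_carrier [simp]: "mat_copies m s M \<in> carrier_mat (m * s) (m * s)"
  by (simp add: mat_copies_def)

lemma mat_copies_mult:
  fixes M M' :: "'a::comm_ring_1 mat"
  assumes M: "M \<in> carrier_mat s s" "M' \<in> carrier_mat s s"
  shows "mat_copies m s (M * M') = mat_copies m s M * mat_copies m s M'"
proof (rule eq_matI)
  fix i j assume "i < dim_row (mat_copies m s M * mat_copies m s M')"
    "j < dim_col (mat_copies m s M * mat_copies m s M')"
  then have ij: "i < m * s" "j < m * s" by (auto simp: mat_copies_def)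
  note b = block_index_bounds[OF ij(1)] block_index_bounds[OF ij(2)]
  have "(mat_copies m s M * mat_copies m s M') $$ (i, j) =
      (\<Sum>t<m. \<Sum>c<s. mat_copies m s M $$ (i, t * s + c) * mat_copies m s M' $$ (t * s + c, j))"
    by (subst mult_mat_entry[OF mat_copies_carrier mat_copies_carrier ij])
       (simp add: sum_lessThan_mult)
  also have "\<dots> = (\<Sum>t<m. if t = i div s then
      (if i div s = j div s then \<Sum>c<s. M $$ (i mod s, c) * M' $$ (c, j mod s) else 0) else 0)"
    using ij by (intro sum.cong refl)
      (auto simp: mat_copies_def block_index_less intro!: sum.cong sum.neutral)
  also have "\<dots> = (if i div s = j div s then (M * M') $$ (i mod s, j mod s) else 0)"
    using b by (simp add: mult_mat_entry[OF M])
  also have "\<dots> = mat_copies m s (M * M') $$ (i, j)"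
    using ij by (simp add: mat_copies_def)
  finally show "mat_copies m s (M * M') $$ (i, j) =
      (mat_copies m s M * mat_copies m s M') $$ (i, j)" ..
qed (auto simp: mat_copies_def)

lemma nc_hom_mat_copies:
  "nc_hom (mat_alg s :: ('k::field, 'k mat) module) (mat_alg (m * s)) (mat_copies m s)"
proof -
  have "mat_copies m s (1\<^sub>m s) = (1\<^sub>m (m * s) :: 'k mat)"
  proof (rule eq_matI)
    fix i j assume "i < dim_row (1\<^sub>m (m * s) :: 'k mat)" "j < dim_col (1\<^sub>m (m * s) :: 'k mat)"
    then have ij: "i < m * s" "j < m * s" by auto
    have "i = j \<longleftrightarrow> i div s = j div s \<and> i mod s = j mod s"
      by (metis div_mult_mod_eq)
    then show "mat_copies m s (1\<^sub>m s) $$ (i, j) = (1\<^sub>m (m * s) :: 'k mat) $$ (i, j)"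
      using ij block_index_bounds[OF ij(1)] block_index_bounds[OF ij(2)]
      by (simp add: mat_copies_def)
  qed (auto simp: mat_copies_def)
  moreover have "mat_copies m s (0\<^sub>m s s) = (0\<^sub>m (m * s) (m * s) :: 'k mat)"
    by (rule eq_matI) (auto simp: mat_copies_def block_index_bounds)
  moreover have "mat_copies m s (X + Y) = mat_copies m s X + mat_copies m s Y"
    if "X \<in> carrier_mat s s" "Y \<in> carrier_mat s s" for X Y :: "'k mat"
    by (rule eq_matI) (use that in \<open>auto simp: mat_copies_def block_index_bounds\<close>)
  moreover have "mat_copies m s (c \<cdot>\<^sub>m X) = c \<cdot>\<^sub>m mat_copies m s X"
    if "X \<in> carrier_mat s s" for c and X :: "'k mat"
    by (rule eq_matI) (use that in \<open>auto simp: mat_copies_def block_index_bounds\<close>)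
  ultimately show ?thesis
    by (simp add: nc_hom_def module_mat_simps mat_copies_mult)
qed

lemma mat_tuples_size: "A \<in> mat_tuples s \<Longrightarrow> A \<in> mat_tuples s' \<Longrightarrow> s' = s"
  unfolding mat_tuples_def by (metis (mono_tags, lifting) carrier_matD(1) mem_Collect_eq)

text \<open>For a point \<open>A\<close> of the domain, take the line with \<open>P \<otimes> 1\<close> at the parameter \<open>0\<close> and \<open>1 \<otimes> A\<close> at the
parameter \<open>1\<close>. The fraction on this line has the expansion zero, so its numerator is zero, and its
denominator does not vanish at \<open>1\<close>. Hence \<open>1 \<otimes> r(A) = 0\<close>.\<close>

lemma rational_identity_of_zero_series:
  fixes r :: "('x::finite, 'k::field_char_0) nc_expr"
  assumes m: "m \<ge> 1" and def: "nc_defined (gs_alg m) (gs_shift m P) r"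
    and zero: "nc_eval (gs_alg m) (gs_shift m P) r = gs_zero"
  shows "rational_identity r"
  unfolding rational_identity_def identity_on_size_def
proof (intro allI ballI)
  fix s and A :: "'x \<Rightarrow> 'k mat"
  assume "A \<in> nc_dom r \<inter> mat_tuples s"
  then obtain s' where A: "A \<in> mat_tuples s" and s': "A \<in> mat_tuples s'" "nc_defined (mat_alg s') A r"
    by (auto simp: nc_dom_def)
  have "s' = s" using A s'(1) by (rule mat_tuples_size)
  then have defA: "nc_defined (mat_alg s) A r" using s' by simp
  let ?N = "m * s"
  define Z where "Z x = mat_copies m s (A x) - inflate m s (P x)" for x
  have at1: "line_at m s P Z 1 = (\<lambda>x. mat_copies m s (A x))"
    by (rule ext, rule eq_matI) (auto simp: line_mat_def Z_def inflate_def mat_copies_def)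
  have Ac: "A x \<in> carrier (mat_alg s)" for x
    using A by (simp add: mat_tuples_def module_mat_simps)
  have hom: "nc_defined (mat_alg ?N) (line_at m s P Z 1) r"
    "nc_eval (mat_alg ?N) (line_at m s P Z 1) r = mat_copies m s (nc_eval (mat_alg s) A r)"
    using nc_eval_hom[OF nc_algebra_mat_alg nc_algebra_mat_alg nc_hom_mat_copies Ac defA]
    by (auto simp: at1)
  obtain M d where frac: "fraction_on_line m s P Z r M d"
    using fraction_on_line_exists[OF def] by blast
  have M: "M \<in> carrier_mat ?N ?N" using frac by (simp add: fraction_on_line_def)
  have F: "map_mat fps_of_poly M = 0\<^sub>m ?N ?N"
    using frac unfolding fraction_on_line_def zero gs_eval_zero by auto
  have M0: "M $$ (i, j) = 0" if "i < ?N" "j < ?N" for i j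
    using arg_cong[OF F, of "\<lambda>X. X $$ (i, j)"] that M by simp
  have d1: "poly d 1 \<noteq> 0" using frac hom(1) by (auto simp: fraction_on_line_def)
  then have val: "poly d 1 \<cdot>\<^sub>m mat_copies m s (nc_eval (mat_alg s) A r) =
      map_mat (\<lambda>p. poly p 1) M"
    using frac hom(2) unfolding fraction_on_line_def by metis
  have rA: "nc_eval (mat_alg s) A r \<in> carrier_mat s s"
    by (rule nc_eval_mat_carrier[OF A defA])
  show "nc_eval (mat_alg s) A r = 0\<^sub>m s s"
  proof (rule eq_matI)
    fix i j assume "i < dim_row (0\<^sub>m s s :: 'k mat)" "j < dim_col (0\<^sub>m s s :: 'k mat)"
    then have ij: "i < s" "j < s" by auto
    then have ijN: "i < ?N" "j < ?N"
      using m block_index_less[of 0 m] by force+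
    have "poly d 1 * nc_eval (mat_alg s) A r $$ (i, j) = 0"
      using arg_cong[OF val, of "\<lambda>X. X $$ (i, j)"] ijN ij M M0[OF ijN]
      by (simp add: mat_copies_def)
    then show "nc_eval (mat_alg s) A r $$ (i, j) = (0\<^sub>m s s) $$ (i, j)"
      using d1 ij by simp
  qed (use rA in auto)
qed

theorem theorem3p8:
  fixes r :: "('x::finite, 'k::field_char_0) nc_expr"
    and m n :: nat
    and P :: "'x \<Rightarrow> 'k mat"
    and c b :: "nat \<Rightarrow> 'k mat"
    and A :: "'x \<Rightarrow> nat \<Rightarrow> nat \<Rightarrow> ('x, 'k) gseries"
  assumes "realization_about m n r P c A b"
    and "identity_on_size r (m * nat \<lceil>real (m * n) / 2\<rceil>)"
  shows "rational_identity r"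
proof -
  define s where "s = nat \<lceil>real (m * n) / 2\<rceil>"
  let ?S = "nc_eval (gs_alg m) (gs_shift m P) r"
  have P: "P \<in> nc_dom r" "P \<in> mat_tuples m" and lin: "linear_representation m n c A b"
    and def: "nc_defined (gs_alg m) (gs_shift m P) r" and rep: "represents m n c A b ?S"
    using assms(1) by (auto simp: realization_about_def)
  have m: "m \<ge> 1" using P mat_tuples_size by (auto simp: nc_dom_def)
  have "real (m * n) / 2 \<le> real s" unfolding s_def by linarith
  then have s: "n * m \<le> 2 * s" by (simp add: mult.commute flip: of_nat_mult)
  have "?S = gs_zero"
  proof (rule gs_eq_of_coord)
    show "?S \<in> gs_carrier m"
      using nc_algebra.nc_eval_closed[OF nc_algebra_gs_alg gs_shift_closed def] by simp
    fix p q and v :: "('x \<times> nat \<times> nat) list"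
    assume pq: "p < m" "q < m" and v: "set v \<subseteq> gs_letters m"
    show "gs_coord ?S p q v = gs_coord gs_zero p q v"
    proof (rule ccontr)
      assume "gs_coord ?S p q v \<noteq> gs_coord gs_zero p q v"
      then obtain w where w: "set w \<subseteq> gs_letters m" "length w < n * m" "gs_coord ?S p q w \<noteq> 0"
        using represents_nonzero_short_word[OF lin rep pq v] by auto
      \<comment> \<open>The size of the hypothesis is \<open>m s\<close>, with \<open>s\<close> large enough to see words of length below \<open>n m\<close>.\<close>
      have vanish: "gs_eval m s Z ?S = gs_eval m s Z gs_zero" for Z
      proof -
        obtain M d where "fraction_on_line m s P Z r M d"
          using fraction_on_line_exists[OF def] by blast
        moreover have "m * s \<ge> 1" using m w(2) s by (cases s) auto
        ultimately show ?thesis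
          using fraction_on_line_vanish assms(2) by (simp add: s_def gs_eval_zero)
      qed
      have "gs_coord ?S p q w = gs_coord gs_zero p q w"
        by (rule gs_coord_eq_of_eval[where s = s and l = "length w"])
           (use w s pq in \<open>auto simp: vanish words_def\<close>)
      then show False using w(3) by simp
    qed
  qed (rule gs_closed)
  then show ?thesis
    using rational_identity_of_zero_series[OF m def] by blast
qed

end
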